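(* With the notation of the context, for an extended target with known contour, i.e., vectors $\mathbf m$ and $\mathbf n$ known, the hybrid Cramér–Rao bound $\mathbf C(\mathring d,\mathring\phi,\varphi)$ of $(\mathring d,\mathring\phi,\varphi)$ satisfies, entrywise as $\mathring d\to\infty$, $$\mathbf C(\mathring d,\mathring\phi,\varphi)=\Big(2\frac{E}{N_0}\Big)^{-1}\mathbf T_{11}^{-1}+o(\mathring d^{4}),$$ where $$\mathbf T_{11}^{-1}=\begin{bmatrix}\left(L-\frac{A^2}{B}\right)^{-1}&0&-\left(A-\frac{LB}{A}\right)^{-1}\\ 0&Z^{-1}&Z^{-1}\\ -\left(A-\frac{LB}{A}\right)^{-1}&Z^{-1}&Z^{-1}+\left(B-\frac{A^2}{L}\right)^{-1}\end{bmatrix}$$ is the inverse of $$\mathbf T_{11}=\begin{bmatrix}L&A&-A\\ A&Z+B&-B\\ -A&-B&B\end{bmatrix},$$ with $$A=L\langle\bar w,\bar w\,\bar{\mathbf p}_\perp^{\mathsf T}\mathbf R\boldsymbol\rho\rangle_\star,\qquad B=L\|\bar w\,\bar{\mathbf p}_\perp^{\mathsf T}\mathbf R\boldsymbol\rho\|_\star^2+(\alpha+1)^2\|\operatorname{P}_w^\perp(v)\|_\star^2/\|w\|_\star^2,\qquad Z=M\cos^2\mathring\phi,$$ $\bar w=w/\|w\|_\star$ and $\bar{\mathbf p}_\perp=\mathbf p_\perp/\|\mathbf p_\perp\|$.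
   Context: Contour. Let $\mathbf m=[a_1,\dots,a_Q]^{\mathsf T}$, $\mathbf n=[b_1,\dots,b_Q]^{\mathsf T}\in\mathbb R^Q$ with $a_1,b_1>0$, $\boldsymbol\sigma(u)=[\cos u,\dots,\cos Qu]^{\mathsf T}$, $\boldsymbol\varsigma(u)=[\sin u,\dots,\sin Qu]^{\mathsf T}$, $\boldsymbol\rho(u)=[\boldsymbol\sigma^{\mathsf T}\mathbf m,\ \boldsymbol\varsigma^{\mathsf T}\mathbf n]^{\mathsf T}$ for $0\le u<2\pi$. The target (seen by a radar at the origin) has center $\mathbf p=[\mathring d\cos\mathring\phi,\ \mathring d\sin\mathring\phi]^{\mathsf T}$ and orientation $\varphi$; $\mathbf R=\begin{bmatrix}\cos\varphi&-\sin\varphi\\ \sin\varphi&\cos\varphi\end{bmatrix}$ and the contour is $\mathbf r(u)=\mathbf p+\mathbf R\boldsymbol\rho(u)$. A dot denotes $\partial/\partial u$. Let $d(u)=\|\mathbf r(u)\|$, $\phi(u)$ the polar angle of $\mathbf r(u)$, $\beta(u)$ the polar angle of $\dot{\mathbf r}(u)$. For $\mathbf x\in\mathbb R^2$, $\mathbf x_\perp=\left(\begin{smallmatrix}0&-1\\1&0\end{smallmatrix}\right)\mathbf x$. Parameters: $\boldsymbol\gamma=[\mathring d,\mathring\phi,\varphi,a_1,\dots,a_Q,b_1,\dots,b_Q]^{\mathsf T}$; $\boldsymbol\mu=\partial d/\partial\boldsymbol\gamma$, $\boldsymbol\eta=\partial\phi/\partial\boldsymbol\gamma$, $\boldsymbol\xi=\boldsymbol\eta-\partial\beta/\partial\boldsymbol\gamma$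 (functions of $u$). With $\overline{\sin}\,x=\max(\sin x,0)$ and $\alpha$ the known surface roughness, $w=(\overline{\sin}(\phi-\beta))^{\alpha+1}$, $v=(\overline{\sin}(\phi-\beta))^{\alpha}\cos(\phi-\beta)$. Star product: $\langle f_1,f_2\rangle_\star=\int_0^{2\pi}f_1f_2\|\dot{\mathbf r}(u)\|\,du$, $\|f\|_\star=\langle f,f\rangle_\star^{1/2}$; for vector functions $\langle\mathbf f_1,\mathbf f_2\rangle_\star=\int_0^{2\pi}\mathbf f_1\mathbf f_2^{\mathsf T}\|\dot{\mathbf r}\|\,du$. $\operatorname{P}_w^\perp(\mathbf f)=\mathbf f-\langle\mathbf f,w\rangle_\star\langle w,w\rangle_\star^{-1}w$. The norm $\|\cdot\|$ is Euclidean. Constants: $N$ is the number of antennas of the radar's uniform linear array, $N_0$ the noise power spectral density, $B_{\mathrm{RMS}}$ the effective signal bandwidth, $c$ the speed of light, $L=(4\pi B_{\mathrm{RMS}}/c)^2$, $M=\pi^2(N^2-1)/12$; the channel gain is $g=\sqrt G/\mathring d^2$ with $G$ a constant, and $E\approx g^2N\|w\|_\star^2$ is the received energy. Effective Fisher information matrix of $\boldsymbol\gamma$: $$\mathbf J(\boldsymbol\gamma)=\frac1{\|w\|_\star^2}\frac{2E}{N_0}\Big[L\langle w\boldsymbol\mu,w\boldsymbol\mu\rangle_\star+M\langle w\cos\phi\,\boldsymbol\eta,w\cos\phi\,\boldsymbol\eta\rangle_\star+(\alpha+1)^2\langle\operatorname{P}_w^\perp(v\boldsymbol\xi),\operatorname{P}_w^\perp(v\boldsymbol\xi)\rangle_\star\Big].$$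 When the contour is known, $\mathbf C(\mathring d,\mathring\phi,\varphi)=\mathbf J_{11}^{-1}$, where $\mathbf J_{11}$ is the upper-left $3\times3$ block of $\mathbf J(\boldsymbol\gamma)$. *)

theory Defs
  imports "HOL-Analysis.Analysis" "HOL-Library.Landau_Symbols"
begin

text \<open>
  Vectors of the plane are represented as complex numbers, so that the polar angle is the
  library's \<open>Arg\<close>. The parameter vector is a function on the indices \<open>1, \<dots>, 3 + 2 * Q\<close>.
\<close>

definition param ::
  "nat \<Rightarrow> real \<Rightarrow> real \<Rightarrow> real \<Rightarrow> (nat \<Rightarrow> real) \<Rightarrow> (nat \<Rightarrow> real) \<Rightarrow> nat \<Rightarrow> real" where
  "param Q d0 \<phi>0 \<psi> a b i =
     (if i = 1 then d0 else if i = 2 then \<phi>0 else if i = 3 then \<psi>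
      else if i \<le> 3 + Q then a (i - 3) else b (i - 3 - Q))"

definition rotate_by :: "real \<Rightarrow> complex \<Rightarrow> complex" where
  "rotate_by \<psi> x = Complex (cos \<psi> * Re x - sin \<psi> * Im x) (sin \<psi> * Re x + cos \<psi> * Im x)"

definition perp :: "complex \<Rightarrow> complex" where
  "perp x = Complex (- Im x) (Re x)"

definition centre :: "(nat \<Rightarrow> real) \<Rightarrow> complex" where
  "centre \<gamma> = Complex (\<gamma> 1 * cos (\<gamma> 2)) (\<gamma> 1 * sin (\<gamma> 2))"

definition rho :: "nat \<Rightarrow> (nat \<Rightarrow> real) \<Rightarrow> real \<Rightarrow> complex" where
  "rho Q \<gamma> u = Complex (\<Sum>k=1..Q. \<gamma> (3 + k) * cos (real k * u))
                      (\<Sum>k=1..Q. \<gamma> (3 + Q + k) * sin (real k * u))"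

definition contour :: "nat \<Rightarrow> (nat \<Rightarrow> real) \<Rightarrow> real \<Rightarrow> complex" where
  "contour Q \<gamma> u = centre \<gamma> + rotate_by (\<gamma> 3) (rho Q \<gamma> u)"

definition contour_dot :: "nat \<Rightarrow> (nat \<Rightarrow> real) \<Rightarrow> real \<Rightarrow> complex" where
  "contour_dot Q \<gamma> u = vector_derivative (contour Q \<gamma>) (at u)"

definition contour_dist :: "nat \<Rightarrow> (nat \<Rightarrow> real) \<Rightarrow> real \<Rightarrow> real" where
  "contour_dist Q \<gamma> u = norm (contour Q \<gamma> u)"

definition phi :: "nat \<Rightarrow> (nat \<Rightarrow> real) \<Rightarrow> real \<Rightarrow> real" where
  "phi Q \<gamma> u = Arg (contour Q \<gamma> u)"

definition beta :: "nat \<Rightarrow> (nat \<Rightarrow> real) \<Rightarrow> real \<Rightarrow> real" where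
  "beta Q \<gamma> u = Arg (contour_dot Q \<gamma> u)"

definition partial_deriv :: "nat \<Rightarrow> ((nat \<Rightarrow> real) \<Rightarrow> real) \<Rightarrow> (nat \<Rightarrow> real) \<Rightarrow> real" where
  "partial_deriv i f \<gamma> = deriv (\<lambda>t. f (\<gamma>(i := t))) (\<gamma> i)"

text \<open>
  The principal value \<open>Arg\<close> jumps on the negative real axis. If the first coefficients of both
  coordinates are positive, the contour and its derivative meet that axis for only finitely
  many \<open>u\<close>, so this does not affect the integrals below. Where the derivative of the contour
  vanishes, and with it the polar angle \<open>beta\<close> loses its meaning, the weight of the star product
  is zero.
\<close>

definition mu :: "nat \<Rightarrow> (nat \<Rightarrow> real) \<Rightarrow> nat \<Rightarrow> real \<Rightarrow> real" where
  "mu Q \<gamma> i u = partial_deriv i (\<lambda>\<gamma>. contour_dist Q \<gamma> u) \<gamma>"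

definition eta :: "nat \<Rightarrow> (nat \<Rightarrow> real) \<Rightarrow> nat \<Rightarrow> real \<Rightarrow> real" where
  "eta Q \<gamma> i u = partial_deriv i (\<lambda>\<gamma>. phi Q \<gamma> u) \<gamma>"

definition xi :: "nat \<Rightarrow> (nat \<Rightarrow> real) \<Rightarrow> nat \<Rightarrow> real \<Rightarrow> real" where
  "xi Q \<gamma> i u = eta Q \<gamma> i u - partial_deriv i (\<lambda>\<gamma>. beta Q \<gamma> u) \<gamma>"

definition sin_plus :: "real \<Rightarrow> real" where
  "sin_plus x = max (sin x) 0"

definition w_fun :: "real \<Rightarrow> nat \<Rightarrow> (nat \<Rightarrow> real) \<Rightarrow> real \<Rightarrow> real" where
  "w_fun \<alpha> Q \<gamma> u = sin_plus (phi Q \<gamma> u - beta Q \<gamma> u) powr (\<alpha> + 1)"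

text \<open>
  For \<open>\<alpha> = 0\<close> the convention \<open>0 powr 0 = 0\<close> makes \<open>v\<close> vanish where \<open>w\<close> does, so that
  \<open>(\<alpha> + 1) * v\<close> is the derivative of \<open>w\<close> with respect to the angle difference.
\<close>

definition v_fun :: "real \<Rightarrow> nat \<Rightarrow> (nat \<Rightarrow> real) \<Rightarrow> real \<Rightarrow> real" where
  "v_fun \<alpha> Q \<gamma> u =
     sin_plus (phi Q \<gamma> u - beta Q \<gamma> u) powr \<alpha> * cos (phi Q \<gamma> u - beta Q \<gamma> u)"

definition star_prod ::
  "nat \<Rightarrow> (nat \<Rightarrow> real) \<Rightarrow> (real \<Rightarrow> real) \<Rightarrow> (real \<Rightarrow> real) \<Rightarrow> real" where
  "star_prod Q \<gamma> f g =
     (LINT u:{0..2*pi}|lebesgue. f u * g u * norm (contour_dot Q \<gamma> u))"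

definition star_norm :: "nat \<Rightarrow> (nat \<Rightarrow> real) \<Rightarrow> (real \<Rightarrow> real) \<Rightarrow> real" where
  "star_norm Q \<gamma> f = sqrt (star_prod Q \<gamma> f f)"

definition proj_perp ::
  "nat \<Rightarrow> (nat \<Rightarrow> real) \<Rightarrow> (real \<Rightarrow> real) \<Rightarrow> (real \<Rightarrow> real) \<Rightarrow> real \<Rightarrow> real" where
  "proj_perp Q \<gamma> w f = (\<lambda>u. f u - star_prod Q \<gamma> f w * inverse (star_prod Q \<gamma> w w) * w u)"

definition received_energy :: "real \<Rightarrow> nat \<Rightarrow> real \<Rightarrow> nat \<Rightarrow> (nat \<Rightarrow> real) \<Rightarrow> real" where
  "received_energy G N \<alpha> Q \<gamma> =
     (sqrt G / (\<gamma> 1)\<^sup>2)\<^sup>2 * real N * (star_norm Q \<gamma> (w_fun \<alpha> Q \<gamma>))\<^sup>2"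

definition EFIM ::
  "real \<Rightarrow> real \<Rightarrow> real \<Rightarrow> real \<Rightarrow> real \<Rightarrow> nat \<Rightarrow> (nat \<Rightarrow> real) \<Rightarrow> nat \<Rightarrow> nat \<Rightarrow> real" where
  "EFIM L M E N0 \<alpha> Q \<gamma> i j =
     (let w = w_fun \<alpha> Q \<gamma>; v = v_fun \<alpha> Q \<gamma> in
      1 / (star_norm Q \<gamma> w)\<^sup>2 * (2 * E / N0) *
      (L * star_prod Q \<gamma> (\<lambda>u. w u * mu Q \<gamma> i u) (\<lambda>u. w u * mu Q \<gamma> j u)
       + M * star_prod Q \<gamma> (\<lambda>u. w u * cos (phi Q \<gamma> u) * eta Q \<gamma> i u)
                           (\<lambda>u. w u * cos (phi Q \<gamma> u) * eta Q \<gamma> j u)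
       + (\<alpha> + 1)\<^sup>2 * star_prod Q \<gamma> (proj_perp Q \<gamma> w (\<lambda>u. v u * xi Q \<gamma> i u))
                                    (proj_perp Q \<gamma> w (\<lambda>u. v u * xi Q \<gamma> j u))))"

definition EFIM11 ::
  "real \<Rightarrow> real \<Rightarrow> real \<Rightarrow> real \<Rightarrow> real \<Rightarrow> nat \<Rightarrow> (nat \<Rightarrow> real) \<Rightarrow> real^3^3" where
  "EFIM11 L M E N0 \<alpha> Q \<gamma> =
     (let J = EFIM L M E N0 \<alpha> Q \<gamma> in
      vector [vector [J 1 1, J 1 2, J 1 3],
              vector [J 2 1, J 2 2, J 2 3],
              vector [J 3 1, J 3 2, J 3 3]])"

definition CRB_known_contour ::
  "real \<Rightarrow> real \<Rightarrow> real \<Rightarrow> real \<Rightarrow> real \<Rightarrow> nat \<Rightarrow> (nat \<Rightarrow> real) \<Rightarrow> real^3^3" where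
  "CRB_known_contour L M E N0 \<alpha> Q \<gamma> = matrix_inv (EFIM11 L M E N0 \<alpha> Q \<gamma>)"

definition w_bar :: "real \<Rightarrow> nat \<Rightarrow> (nat \<Rightarrow> real) \<Rightarrow> real \<Rightarrow> real" where
  "w_bar \<alpha> Q \<gamma> u = w_fun \<alpha> Q \<gamma> u / star_norm Q \<gamma> (w_fun \<alpha> Q \<gamma>)"

definition cross_range :: "nat \<Rightarrow> (nat \<Rightarrow> real) \<Rightarrow> real \<Rightarrow> real" where
  "cross_range Q \<gamma> u =
     inner (perp (centre \<gamma>) /\<^sub>R norm (perp (centre \<gamma>))) (rotate_by (\<gamma> 3) (rho Q \<gamma> u))"

definition coef_A :: "real \<Rightarrow> real \<Rightarrow> nat \<Rightarrow> (nat \<Rightarrow> real) \<Rightarrow> real" where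
  "coef_A L \<alpha> Q \<gamma> =
     L * star_prod Q \<gamma> (w_bar \<alpha> Q \<gamma>) (\<lambda>u. w_bar \<alpha> Q \<gamma> u * cross_range Q \<gamma> u)"

definition coef_B :: "real \<Rightarrow> real \<Rightarrow> nat \<Rightarrow> (nat \<Rightarrow> real) \<Rightarrow> real" where
  "coef_B L \<alpha> Q \<gamma> =
     L * (star_norm Q \<gamma> (\<lambda>u. w_bar \<alpha> Q \<gamma> u * cross_range Q \<gamma> u))\<^sup>2
     + (\<alpha> + 1)\<^sup>2 * (star_norm Q \<gamma> (proj_perp Q \<gamma> (w_fun \<alpha> Q \<gamma>) (v_fun \<alpha> Q \<gamma>)))\<^sup>2
       / (star_norm Q \<gamma> (w_fun \<alpha> Q \<gamma>))\<^sup>2"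

definition coef_Z :: "real \<Rightarrow> (nat \<Rightarrow> real) \<Rightarrow> real" where
  "coef_Z M \<gamma> = M * (cos (\<gamma> 2))\<^sup>2"

definition T11 :: "real \<Rightarrow> real \<Rightarrow> real \<Rightarrow> nat \<Rightarrow> (nat \<Rightarrow> real) \<Rightarrow> real^3^3" where
  "T11 L M \<alpha> Q \<gamma> =
     (let A = coef_A L \<alpha> Q \<gamma>; B = coef_B L \<alpha> Q \<gamma>; Z = coef_Z M \<gamma> in
      vector [vector [  L,     A, - A],
              vector [  A, Z + B, - B],
              vector [- A,   - B,   B]])"

text \<open>
  The entry \<open>- inverse (A - L * B / A)\<close> stands for \<open>A / (L * B - A\<^sup>2)\<close>. For \<open>A = 0\<close> it evaluates to
  0, the value of the latter, because \<open>x / 0 = 0\<close> and \<open>inverse 0 = 0\<close>.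
\<close>

definition T11_inv :: "real \<Rightarrow> real \<Rightarrow> real \<Rightarrow> nat \<Rightarrow> (nat \<Rightarrow> real) \<Rightarrow> real^3^3" where
  "T11_inv L M \<alpha> Q \<gamma> =
     (let A = coef_A L \<alpha> Q \<gamma>; B = coef_B L \<alpha> Q \<gamma>; Z = coef_Z M \<gamma> in
      vector [vector [inverse (L - A\<^sup>2 / B),     0,         - inverse (A - L * B / A)],
              vector [0,                         inverse Z, inverse Z],
              vector [- inverse (A - L * B / A), inverse Z, inverse Z + inverse (B - A\<^sup>2 / L)]])"

end

theory Submission
  imports Defs
begin

text \<open>
  As \<open>d \<rightarrow> \<infinity>\<close> the unit vector towards a contour point tends to the line of sight \<open>cis \<phi>0\<close>. Hence,
  after division by \<open>2 * E / N0\<close>, all integrands of the Fisher information converge boundedly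
  outside a finite set, and by dominated convergence the normalized information matrix and \<open>T11\<close>
  have the same limit. The determinant of the limit is \<open>Z * (L * B - A\<^sup>2)\<close>, which is positive by the
  strict Cauchy-Schwarz inequality, so the difference of the two inverse matrices tends to zero.
  The bound multiplies it by \<open>inverse (2 * E / N0)\<close>, which has order \<open>d ^ 4\<close>. The exceptional
  arguments are zeros of nonconstant trigonometric polynomials, that is, of polynomials in \<open>cis u\<close>
  divided by a power of \<open>cis u\<close>.
\<close>

subsection \<open>Trigonometric polynomials and polar angles\<close>

text \<open>\<open>T11\<close> itself varies with \<open>d\<close>, because \<open>w\<close> and
  \<open>v\<close> contain the true polar angle of every contour point; a common limit is therefore
  the natural way to compare it with the information matrix. Every entry is divided by the squared
  star norm of the weight, so the limit makes sense only because some arc of the contour faces the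
  radar. Jumps of \<open>Arg\<close> are avoided by trading angles for complex quotients. Off the
  real axis \<open>cis (phi - beta)\<close> is the quotient of two unit vectors, whose parts are the
  sine and cosine in \<open>w\<close> and \<open>v\<close>; the derivatives of modulus and polar
  angle are the real and imaginary parts of a logarithmic derivative. One discontinuity remains: for
  \<alpha> = 0 the function \<open>v\<close> jumps at grazing incidence, so pointwise convergence is
  asked only off a finite set. The sign pattern of \<open>T11\<close> has a geometric origin:
  turning centre and target together about the radar changes neither the distance nor
  \<open>phi - beta\<close>.\<close>

lemma finite_trig_level_set:
  fixes x y :: "nat \<Rightarrow> real" and \<kappa> :: real
  assumes Q: "1 \<le> Q" and nz: "x 1 \<noteq> 0 \<or> y 1 \<noteq> 0"
  shows "finite {u \<in> {0..2*pi}. (\<Sum>k=1..Q. x k * cos (real k * u) + y k * sin (real k * u)) = \<kappa>}"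
proof -
  \<comment> \<open>\<open>c k * cis (k * u)\<close> plus its conjugate is twice the
    \<open>k\<close>-th summand, so \<open>poly p (cis u)\<close> is \<open>2 * cis u ^ Q\<close>
    times the difference of the sum and \<kappa>. The shift by \<open>Q\<close> keeps all exponents
    nonnegative.\<close>
  define c where "c k = Complex (x k) (- y k)" for k
  define p where "p = (\<Sum>k=1..Q. monom (c k) (Q + k) + monom (cnj (c k)) (Q - k))
                      - monom (of_real (2 * \<kappa>)) Q"
  \<comment> \<open>Degree \<open>Q + 1\<close> is reached by \<open>k = 1\<close> alone: the
    conjugate terms have degree below \<open>Q\<close>, and the term with \<kappa> has degree
    \<open>Q\<close>.\<close>
  have "coeff p (Q + 1) = (\<Sum>k=1..Q. coeff (monom (c k) (Q + k)) (Q + 1)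
      + coeff (monom (cnj (c k)) (Q - k)) (Q + 1))"
    by (simp add: p_def coeff_sum)
  also have "\<dots> = (\<Sum>k=1..Q. if k = 1 then c k else 0)"
    by (intro sum.cong refl) (auto simp: coeff_monom)
  also have "\<dots> = c 1"
    using Q by (subst sum.delta) auto
  finally have "p \<noteq> 0"
    using nz by (auto simp: c_def complex_eq_iff)
  then have fin: "finite {z. poly p z = 0}"
    by (rule poly_roots_finite)
  have root: "poly p (cis u) = 0"
    if "(\<Sum>k=1..Q. x k * cos (real k * u) + y k * sin (real k * u)) = \<kappa>" for u
  proof -
    have summand: "c k * cis u ^ (Q + k) + cnj (c k) * cis u ^ (Q - k)
        = cis u ^ Q * of_real (2 * (x k * cos (real k * u) + y k * sin (real k * u)))"
      if "k \<in> {1..Q}" for k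
    proof -
      have "cis u ^ (Q - k) = cis u ^ Q * cis (- (real k * u))"
      proof -
        have "real (Q - k) * u = real Q * u + - (real k * u)"
          using that by (simp add: of_nat_diff left_diff_distrib)
        then show ?thesis
          by (metis Complex.DeMoivre cis_mult)
      qed
      moreover have "cis u ^ (Q + k) = cis u ^ Q * cis (real k * u)"
        by (simp add: Complex.DeMoivre cis_mult algebra_simps)
      moreover have "c k * cis (real k * u) + cnj (c k) * cis (- (real k * u))
          = of_real (2 * (x k * cos (real k * u) + y k * sin (real k * u)))"
        by (simp add: c_def complex_eq_iff algebra_simps)
      moreover have "c k * (cis u ^ Q * z) + cnj (c k) * (cis u ^ Q * z')
          = cis u ^ Q * (c k * z + cnj (c k) * z')" for z z'
        by (simp only: distrib_left mult.left_commute)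
      ultimately show ?thesis
        by simp
    qed
    have "poly p (cis u) = (\<Sum>k=1..Q. c k * cis u ^ (Q + k) + cnj (c k) * cis u ^ (Q - k))
            - of_real (2 * \<kappa>) * cis u ^ Q"
      by (simp add: p_def poly_sum poly_monom)
    also have "(\<Sum>k=1..Q. c k * cis u ^ (Q + k) + cnj (c k) * cis u ^ (Q - k))
        = cis u ^ Q * of_real (2 * (\<Sum>k=1..Q. x k * cos (real k * u) + y k * sin (real k * u)))"
      by (subst sum.cong[OF refl summand]) (simp_all add: sum_distrib_left)
    finally show ?thesis
      unfolding that by simp
  qed
  \<comment> \<open>\<open>Arg2pi\<close> inverts \<open>cis\<close> on the half-open interval from
    0 to 2 pi, so the right endpoint is added by hand.\<close>
  have "u \<in> insert (2 * pi) (Arg2pi ` {z. poly p z = 0})"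
    if "u \<in> {0..2*pi}" "(\<Sum>k=1..Q. x k * cos (real k * u) + y k * sin (real k * u)) = \<kappa>" for u
  proof (cases "u = 2 * pi")
    case False
    have "Arg2pi (cis u) = u"
      using that(1) False by (intro Arg2pi_unique[where r=1]) (auto simp: cis_conv_exp)
    then show ?thesis
      using root[OF that(2)] by (intro insertI2 image_eqI[where x = "cis u"]) auto
  qed auto
  then show ?thesis
    using fin by (intro finite_subset[OF _ finite.insertI[OF finite_imageI[OF fin]]]) blast
qed


text \<open>\<open>Arg\<close> is the imaginary part of \<open>Ln\<close>, and the chain rule off
  the branch cut produces the logarithmic derivative \<open>z' / z\<close>.\<close>

lemma has_real_derivative_Arg:
  assumes z: "(z has_vector_derivative z') (at t)" and nonneg: "z t \<notin> \<real>\<^sub>\<le>\<^sub>0"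
  shows "((\<lambda>t. Arg (z t)) has_real_derivative Im (z' / z t)) (at t)"
proof -
  have "((Ln \<circ> z) has_vector_derivative z' * inverse (z t)) (at t)"
    using z nonneg by (intro field_vector_diff_chain_at has_field_derivative_Ln)
  from bounded_linear.has_vector_derivative[OF bounded_linear_Im this]
  have deriv: "((\<lambda>t. Im (Ln (z t))) has_real_derivative Im (z' / z t)) (at t)"
    by (simp add: has_real_derivative_iff_has_vector_derivative divide_inverse)
  have "\<forall>\<^sub>F t in nhds t. z t \<noteq> 0"
  proof -
    have "continuous (at t) z"
      using z by (rule has_vector_derivative_continuous)
    moreover have "z t \<noteq> 0"
      using nonneg by auto
    ultimately show ?thesis
      using tendsto_imp_eventually_ne[of z "z t" "nhds t" 0]
      by (simp add: continuous_at tendsto_at_iff_tendsto_nhds)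
  qed
  then have eq: "\<forall>\<^sub>F t in nhds t. Im (Ln (z t)) = Arg (z t)"
    by eventually_elim (simp add: Arg_eq_Im_Ln)
  from DERIV_cong_ev[OF refl eq refl] deriv show ?thesis
    by simp
qed

text \<open>The real part of the logarithmic derivative is the relative growth rate of the modulus.
  Keeping the complex quotient makes rotations, where \<open>z'\<close> is \<i> times a vector, easy
  to read off.\<close>

lemma has_real_derivative_cmod:
  assumes z: "(z has_vector_derivative z') (at t)" and nz: "z t \<noteq> 0"
  shows "((\<lambda>t. cmod (z t)) has_real_derivative cmod (z t) * Re (z' / z t)) (at t)"
proof -
  have re: "((\<lambda>t. Re (z t)) has_real_derivative Re z') (at t)"
    and im: "((\<lambda>t. Im (z t)) has_real_derivative Im z') (at t)"
    using bounded_linear.has_vector_derivative[OF bounded_linear_Re z]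
      bounded_linear.has_vector_derivative[OF bounded_linear_Im z]
    by (simp_all add: has_real_derivative_iff_has_vector_derivative)
  have pos: "0 < (Re (z t))\<^sup>2 + (Im (z t))\<^sup>2"
    using nz by (simp add: complex_neq_0)
  have "((\<lambda>t. (Re (z t))\<^sup>2 + (Im (z t))\<^sup>2) has_real_derivative
      2 * (Re (z t) * Re z' + Im (z t) * Im z')) (at t)"
    using DERIV_add[OF DERIV_power[OF re, of 2] DERIV_power[OF im, of 2]]
    by (simp add: algebra_simps)
  from DERIV_chain'[OF this DERIV_real_sqrt[OF pos]]
  have "((\<lambda>t. sqrt ((Re (z t))\<^sup>2 + (Im (z t))\<^sup>2)) has_real_derivative
      (Re (z t) * Re z' + Im (z t) * Im z') / cmod (z t)) (at t)"
    unfolding cmod_def by (rule DERIV_cong) (simp only: divide_inverse, simp)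
  moreover have "(Re (z t) * Re z' + Im (z t) * Im z') / cmod (z t) = cmod (z t) * Re (z' / z t)"
  proof -
    have "Re (z' / z t) = (Re (z t) * Re z' + Im (z t) * Im z') / (cmod (z t))\<^sup>2"
      by (simp add: Re_divide cmod_power2 mult.commute)
    then show ?thesis
      using nz by (simp add: power2_eq_square)
  qed
  ultimately show ?thesis
    by (simp add: cmod_def)
qed

subsection \<open>Convergence of matrix inverses\<close>

lemma matrix_inv_eqI:
  fixes A :: "'a::semiring_1^'n^'n"
  assumes "A ** B = mat 1" "B ** A = mat 1"
  shows "matrix_inv A = B"
  unfolding matrix_inv_def
proof (rule some_equality)
  fix C
  assume C: "A ** C = mat 1 \<and> C ** A = mat 1"
  then have "C = C ** (A ** B)"
    using assms by simp
  also have "\<dots> = B"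
    using C by (simp add: matrix_mul_assoc)
  finally show "C = B" .
qed (use assms in simp)

lemma matrix_inv_inverse:
  fixes A :: "'a::semiring_1^'n^'n"
  assumes "invertible A"
  shows "A ** matrix_inv A = mat 1" "matrix_inv A ** A = mat 1"
  using assms matrix_inv_eqI unfolding invertible_def by blast+

text \<open>The \<open>j\<close>-th column of the inverse solves the linear system with right-hand
  side \<open>axis j 1\<close>, to which Cramer's rule applies.\<close>

lemma matrix_inv_nth_cramer:
  fixes A :: "real^'n^'n"
  assumes "det A \<noteq> 0"
  shows "matrix_inv A $ i $ j
      = det (\<chi> k l. if l = i then axis j 1 $ k else A $ k $ l) / det A"
proof -
  have "A *v (matrix_inv A *v axis j 1) = axis j 1"
    using assms matrix_inv_inverse(1)[of A] by (simp add: matrix_vector_mul_assoc invertible_det_nz)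
  then have "matrix_inv A *v axis j 1
      = (\<chi> i. det (\<chi> k l. if l = i then axis j 1 $ k else A $ k $ l) / det A)"
    using cramer[OF assms] by blast
  then have "(matrix_inv A *v axis j 1) $ i
      = det (\<chi> k l. if l = i then axis j 1 $ k else A $ k $ l) / det A"
    by simp
  then show ?thesis
    by (simp only: matrix_vector_mult_basis column_def vec_lambda_beta)
qed

lemma tendsto_det:
  fixes A :: "'a \<Rightarrow> real^'n^'n"
  assumes "\<And>i j. ((\<lambda>x. A x $ i $ j) \<longlongrightarrow> B $ i $ j) F"
  shows "((\<lambda>x. det (A x)) \<longlongrightarrow> det B) F"
  unfolding det_def by (intro tendsto_intros assms)

text \<open>By Cramer's rule the entries of the inverse are quotients of polynomials in the entries
  of the matrix. The nonzero limit determinant keeps the denominators away from zero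
  eventually.\<close>

lemma tendsto_matrix_inv:
  fixes A :: "'a \<Rightarrow> real^'n^'n"
  assumes A: "\<And>i j. ((\<lambda>x. A x $ i $ j) \<longlongrightarrow> B $ i $ j) F" and B: "det B \<noteq> 0"
  shows "((\<lambda>x. matrix_inv (A x) $ i $ j) \<longlongrightarrow> matrix_inv B $ i $ j) F"
proof -
  have "((\<lambda>x. det (\<chi> k l. if l = i then axis j 1 $ k else A x $ k $ l) / det (A x))
      \<longlongrightarrow> matrix_inv B $ i $ j) F"
    unfolding matrix_inv_nth_cramer[OF B]
    using B by (intro tendsto_divide tendsto_det) (simp_all add: A)
  moreover have "\<forall>\<^sub>F x in F. det (A x) \<noteq> 0"
    using tendsto_imp_eventually_ne[OF tendsto_det[OF A] B] .
  then have "\<forall>\<^sub>F x in F. det (\<chi> k l. if l = i then axis j 1 $ k else A x $ k $ l) / det (A x)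
      = matrix_inv (A x) $ i $ j"
    by eventually_elim (simp add: matrix_inv_nth_cramer)
  ultimately show ?thesis
    by (rule Lim_transform_eventually)
qed

lemma matrix_inv_scaleR:
  fixes A :: "real^'n^'n"
  assumes "invertible A" "c \<noteq> 0"
  shows "matrix_inv (c *\<^sub>R A) = inverse c *\<^sub>R matrix_inv A"
  using assms matrix_inv_inverse[of A]
  by (intro matrix_inv_eqI) (simp_all add: matrix_scalar_ac flip: scalar_matrix_assoc)

subsection \<open>The contour and its parameter derivatives\<close>

text \<open>Functions built from \<open>Arg\<close> agree with their closed forms except where the
  contour or its tangent meets the real axis. Such finite sets are null and are stable under the
  pointwise operations in the integrands.\<close>

definition eq_off_finite :: "(real \<Rightarrow> real) \<Rightarrow> (real \<Rightarrow> real) \<Rightarrow> bool" where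
  "eq_off_finite f g \<longleftrightarrow> finite {u \<in> {0..2*pi}. f u \<noteq> g u}"

lemma eq_off_finite_refl [simp]: "eq_off_finite f f"
  by (simp add: eq_off_finite_def)

lemma eq_off_finiteI:
  assumes "finite X" "\<And>u. u \<in> {0..2*pi} \<Longrightarrow> u \<notin> X \<Longrightarrow> f u = g u"
  shows "eq_off_finite f g"
  unfolding eq_off_finite_def by (rule finite_subset[OF _ assms(1)]) (use assms(2) in auto)

lemma eq_off_finite_comp2:
  assumes "eq_off_finite f f'" "eq_off_finite g g'"
  shows "eq_off_finite (\<lambda>u. h (f u) (g u)) (\<lambda>u. h (f' u) (g' u))"
  using finite_UnI[OF assms[unfolded eq_off_finite_def]] unfolding eq_off_finite_def
  by (rule rev_finite_subset) auto

lemma star_prod_cong: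
  assumes "eq_off_finite f f'" "eq_off_finite g g'"
  shows "star_prod Q \<gamma> f g = star_prod Q \<gamma> f' g'"
proof -
  let ?X = "{u \<in> {0..2*pi}. f u \<noteq> f' u} \<union> {u \<in> {0..2*pi}. g u \<noteq> g' u}"
  have "countable ?X"
    using assms unfolding eq_off_finite_def by (intro countable_finite) auto
  then show ?thesis
    unfolding star_prod_def set_lebesgue_integral_def
    by (rule integral_discrete_difference) (auto simp: indicator_def)
qed

lemma proj_perp_cong:
  assumes "eq_off_finite w w'" "eq_off_finite f f'"
  shows "eq_off_finite (proj_perp Q \<gamma> w f) (proj_perp Q \<gamma> w' f')"
  unfolding proj_perp_def star_prod_cong[OF assms(2,1)] star_prod_cong[OF assms(1,1)]
  using eq_off_finite_comp2[OF assms(2,1)] .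

section \<open>Derivatives of distance and polar angles with respect to centre and
  orientation\<close>

lemma rotate_by_eq: "rotate_by t z = cis t * z"
  by (simp add: rotate_by_def complex_eq_iff)

lemma centre_eq: "centre \<gamma> = of_real (\<gamma> 1) * cis (\<gamma> 2)"
  by (simp add: centre_def complex_eq_iff)

definition rho_dot :: "nat \<Rightarrow> (nat \<Rightarrow> real) \<Rightarrow> real \<Rightarrow> complex" where
  "rho_dot Q \<gamma> u = Complex (\<Sum>k=1..Q. - (real k * \<gamma> (3 + k) * sin (real k * u)))
                           (\<Sum>k=1..Q. real k * \<gamma> (3 + Q + k) * cos (real k * u))"

lemma has_vector_derivative_rho:
  "(rho Q \<gamma> has_vector_derivative rho_dot Q \<gamma> u) (at u)"
proof -
  have "((\<lambda>u. Re (rho Q \<gamma> u)) has_real_derivative Re (rho_dot Q \<gamma> u)) (at u)"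
    "((\<lambda>u. Im (rho Q \<gamma> u)) has_real_derivative Im (rho_dot Q \<gamma> u)) (at u)"
    unfolding rho_def rho_dot_def
    by (auto intro!: derivative_eq_intros sum.cong)
  then have "((\<lambda>u. of_real (Re (rho Q \<gamma> u)) + \<i> * of_real (Im (rho Q \<gamma> u))) has_vector_derivative
      of_real (Re (rho_dot Q \<gamma> u)) + \<i> * of_real (Im (rho_dot Q \<gamma> u))) (at u)"
    by (intro has_vector_derivative_add has_vector_derivative_mult_right has_vector_derivative_of_real)
      (simp_all add: has_real_derivative_iff_has_vector_derivative)
  then show ?thesis
    by (simp only: complex_eq[symmetric])
qed

lemma contour_dot_eq: "contour_dot Q \<gamma> u = cis (\<gamma> 3) * rho_dot Q \<gamma> u"
  unfolding contour_dot_def contour_def rotate_by_eq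
  by (intro vector_derivative_at)
    (auto intro!: derivative_eq_intros has_vector_derivative_rho)

lemma contour_eq: "contour Q \<gamma> u = of_real (\<gamma> 1) * cis (\<gamma> 2) + cis (\<gamma> 3) * rho Q \<gamma> u"
  by (simp add: contour_def centre_eq rotate_by_eq)

lemma rho_upd: "i \<le> 3 \<Longrightarrow> rho Q (\<gamma>(i := t)) = rho Q \<gamma>"
  by (intro ext) (simp add: rho_def)

lemma rho_dot_upd: "i \<le> 3 \<Longrightarrow> rho_dot Q (\<gamma>(i := t)) = rho_dot Q \<gamma>"
  by (intro ext) (simp add: rho_dot_def)

lemma has_vector_derivative_cis: "(cis has_vector_derivative \<i> * cis t) (at t)"
  unfolding cis_conv_exp
  by (auto intro!: derivative_eq_intros has_vector_derivative_real_field)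

context
  fixes Q :: nat and \<gamma> :: "nat \<Rightarrow> real" and u :: real
begin

text \<open>Changing the bearing rotates only the centre, which is written as contour minus rotated
  shape so that division by the contour leaves 1 minus a small quotient.\<close>

lemma contour_curves:
  "((\<lambda>t. contour Q (\<gamma>(1 := t)) u) has_vector_derivative cis (\<gamma> 2)) (at (\<gamma> 1))"
  "((\<lambda>t. contour Q (\<gamma>(2 := t)) u) has_vector_derivative
      \<i> * (contour Q \<gamma> u - cis (\<gamma> 3) * rho Q \<gamma> u)) (at (\<gamma> 2))"
  "((\<lambda>t. contour Q (\<gamma>(3 := t)) u) has_vector_derivative \<i> * (cis (\<gamma> 3) * rho Q \<gamma> u)) (at (\<gamma> 3))"
  unfolding contour_eq
  by (auto intro!: derivative_eq_intros has_vector_derivative_cis simp: rho_upd)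

lemma contour_dot_curve:
  "((\<lambda>t. contour_dot Q (\<gamma>(3 := t)) u) has_vector_derivative \<i> * contour_dot Q \<gamma> u) (at (\<gamma> 3))"
  unfolding contour_dot_eq
  by (auto intro!: derivative_eq_intros has_vector_derivative_cis simp: rho_dot_upd)

text \<open>The second and third derivatives are opposite because increasing bearing and orientation
  together rotates the scene about the radar and keeps all distances.\<close>

lemma mu_eq:
  assumes "contour Q \<gamma> u \<noteq> 0"
  shows "mu Q \<gamma> 1 u = cmod (contour Q \<gamma> u) * Re (cis (\<gamma> 2) / contour Q \<gamma> u)"
    and "mu Q \<gamma> 2 u = cmod (contour Q \<gamma> u) * Im (cis (\<gamma> 3) * rho Q \<gamma> u / contour Q \<gamma> u)"
    and "mu Q \<gamma> 3 u = - (cmod (contour Q \<gamma> u) * Im (cis (\<gamma> 3) * rho Q \<gamma> u / contour Q \<gamma> u))"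
  using has_real_derivative_cmod[OF contour_curves(1)] has_real_derivative_cmod[OF contour_curves(2)]
    has_real_derivative_cmod[OF contour_curves(3)] assms
  by (auto simp: mu_def partial_deriv_def contour_dist_def distrib_left right_diff_distrib diff_divide_distrib
      simp flip: times_divide_eq_right dest!: DERIV_imp_deriv)

lemma eta_eq:
  assumes "contour Q \<gamma> u \<notin> \<real>\<^sub>\<le>\<^sub>0"
  shows "eta Q \<gamma> 1 u = Im (cis (\<gamma> 2) / contour Q \<gamma> u)"
    and "eta Q \<gamma> 2 u = 1 - Re (cis (\<gamma> 3) * rho Q \<gamma> u / contour Q \<gamma> u)"
    and "eta Q \<gamma> 3 u = Re (cis (\<gamma> 3) * rho Q \<gamma> u / contour Q \<gamma> u)"
  using has_real_derivative_Arg[OF contour_curves(1)] has_real_derivative_Arg[OF contour_curves(2)]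
    has_real_derivative_Arg[OF contour_curves(3)] assms
  by (auto simp: eta_def partial_deriv_def phi_def right_diff_distrib diff_divide_distrib
      simp flip: times_divide_eq_right dest!: DERIV_imp_deriv)

text \<open>The tangent is \<open>cis (\<gamma> 3)\<close> times a vector free of the first three
  parameters, so \<open>beta\<close> turns at unit rate with the orientation and ignores the centre.
  Entries 2 and 3 become opposite, since a common rotation preserves
  \<open>phi - beta\<close>.\<close>

lemma xi_eq:
  assumes "contour Q \<gamma> u \<notin> \<real>\<^sub>\<le>\<^sub>0" "contour_dot Q \<gamma> u \<notin> \<real>\<^sub>\<le>\<^sub>0"
  shows "xi Q \<gamma> 1 u = Im (cis (\<gamma> 2) / contour Q \<gamma> u)"
    and "xi Q \<gamma> 2 u = 1 - Re (cis (\<gamma> 3) * rho Q \<gamma> u / contour Q \<gamma> u)"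
    and "xi Q \<gamma> 3 u = - (1 - Re (cis (\<gamma> 3) * rho Q \<gamma> u / contour Q \<gamma> u))"
proof -
  have "partial_deriv 1 (\<lambda>\<gamma>. beta Q \<gamma> u) \<gamma> = 0" "partial_deriv 2 (\<lambda>\<gamma>. beta Q \<gamma> u) \<gamma> = 0"
    by (simp_all add: partial_deriv_def beta_def contour_dot_eq rho_dot_upd)
  moreover have "partial_deriv 3 (\<lambda>\<gamma>. beta Q \<gamma> u) \<gamma> = 1"
  proof -
    have "contour_dot Q \<gamma> u \<noteq> 0"
      using assms by auto
    then show ?thesis
      using DERIV_imp_deriv[OF has_real_derivative_Arg[OF contour_dot_curve]] assms
      by (simp add: partial_deriv_def beta_def)
  qed
  ultimately show "xi Q \<gamma> 1 u = Im (cis (\<gamma> 2) / contour Q \<gamma> u)"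
    "xi Q \<gamma> 2 u = 1 - Re (cis (\<gamma> 3) * rho Q \<gamma> u / contour Q \<gamma> u)"
    "xi Q \<gamma> 3 u = - (1 - Re (cis (\<gamma> 3) * rho Q \<gamma> u / contour Q \<gamma> u))"
    using eta_eq[OF assms(1)] by (simp_all add: xi_def)
qed

end

subsection \<open>Bounded convergence\<close>

text \<open>The hypotheses of dominated convergence on one period, packaged so that sums and
  products inherit them. The bound is only eventual because \<open>1 / point d u\<close> is
  controlled only for large \<open>d\<close>; the exceptional set admits the jump of
  \<open>v\<close> at grazing incidence.\<close>

definition bounded_conv :: "(real \<Rightarrow> real \<Rightarrow> real) \<Rightarrow> (real \<Rightarrow> real) \<Rightarrow> bool" where
  "bounded_conv F f \<longleftrightarrow> f \<in> borel_measurable borel \<and>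
     (\<exists>K. \<forall>\<^sub>F d in at_top. F d \<in> borel_measurable borel \<and> (\<forall>u\<in>{0..2*pi}. \<bar>F d u\<bar> \<le> K)) \<and>
     (\<exists>X. finite X \<and> (\<forall>u\<in>{0..2*pi} - X. ((\<lambda>d. F d u) \<longlongrightarrow> f u) at_top))"

lemma bounded_convI:
  assumes "f \<in> borel_measurable borel"
    and "\<forall>\<^sub>F d in at_top. F d \<in> borel_measurable borel"
    and "\<forall>\<^sub>F d in at_top. \<forall>u\<in>{0..2*pi}. \<bar>F d u\<bar> \<le> K"
    and "finite X" "\<And>u. u \<in> {0..2*pi} \<Longrightarrow> u \<notin> X \<Longrightarrow> ((\<lambda>d. F d u) \<longlongrightarrow> f u) at_top"
  shows "bounded_conv F f"
  unfolding bounded_conv_def using assms eventually_conj[OF assms(2,3)] by blast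

lemma bounded_convE:
  assumes "bounded_conv F f"
  obtains K X where "f \<in> borel_measurable borel"
    "\<forall>\<^sub>F d in at_top. F d \<in> borel_measurable borel"
    "\<forall>\<^sub>F d in at_top. \<forall>u\<in>{0..2*pi}. \<bar>F d u\<bar> \<le> K"
    "finite X" "\<And>u. u \<in> {0..2*pi} \<Longrightarrow> u \<notin> X \<Longrightarrow> ((\<lambda>d. F d u) \<longlongrightarrow> f u) at_top"
proof -
  from assms obtain K X where *: "f \<in> borel_measurable borel"
    "\<forall>\<^sub>F d in at_top. F d \<in> borel_measurable borel \<and> (\<forall>u\<in>{0..2*pi}. \<bar>F d u\<bar> \<le> K)"
    "finite X" "\<forall>u\<in>{0..2*pi} - X. ((\<lambda>d. F d u) \<longlongrightarrow> f u) at_top"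
    unfolding bounded_conv_def by (elim conjE exE)
  show thesis
    by (rule that[OF *(1) _ _ *(3)]) (use *(2,4) in \<open>auto elim: eventually_mono\<close>)
qed

lemma bounded_conv_fun:
  assumes "f \<in> borel_measurable borel" "\<And>u. u \<in> {0..2*pi} \<Longrightarrow> \<bar>f u\<bar> \<le> K"
  shows "bounded_conv (\<lambda>d. f) f"
  by (rule bounded_convI[where X = "{}" and K = K]) (use assms in auto)

text \<open>Its main use is the coefficient of a projection, which depends on \<open>d\<close> alone
  but enters products of integrands.\<close>

lemma bounded_conv_scalar:
  assumes "(c \<longlongrightarrow> c0) at_top"
  shows "bounded_conv (\<lambda>d u. c d) (\<lambda>u. c0)"
proof (rule bounded_convI[where X = "{}"])
  have "((\<lambda>d. \<bar>c d\<bar>) \<longlongrightarrow> \<bar>c0\<bar>) at_top"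
    using assms by (rule tendsto_rabs)
  from order_tendstoD(2)[OF this, of "\<bar>c0\<bar> + 1"]
  show "\<forall>\<^sub>F d in at_top. \<forall>u\<in>{0..2*pi}. \<bar>c d\<bar> \<le> \<bar>c0\<bar> + 1"
    by (auto elim: eventually_mono)
qed (use assms in auto)

lemma bounded_conv_add:
  assumes "bounded_conv F f" "bounded_conv G g"
  shows "bounded_conv (\<lambda>d u. F d u + G d u) (\<lambda>u. f u + g u)"
proof -
  obtain K1 X1 where F: "f \<in> borel_measurable borel"
      "\<forall>\<^sub>F d in at_top. F d \<in> borel_measurable borel"
      "\<forall>\<^sub>F d in at_top. \<forall>u\<in>{0..2*pi}. \<bar>F d u\<bar> \<le> K1"
      "finite X1" "\<And>u. u \<in> {0..2*pi} \<Longrightarrow> u \<notin> X1 \<Longrightarrow> ((\<lambda>d. F d u) \<longlongrightarrow> f u) at_top"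
    by (rule bounded_convE[OF assms(1)]; rule that)
  obtain K2 X2 where G: "g \<in> borel_measurable borel"
      "\<forall>\<^sub>F d in at_top. G d \<in> borel_measurable borel"
      "\<forall>\<^sub>F d in at_top. \<forall>u\<in>{0..2*pi}. \<bar>G d u\<bar> \<le> K2"
      "finite X2" "\<And>u. u \<in> {0..2*pi} \<Longrightarrow> u \<notin> X2 \<Longrightarrow> ((\<lambda>d. G d u) \<longlongrightarrow> g u) at_top"
    by (rule bounded_convE[OF assms(2)]; rule that)
  have bnd: "\<bar>s + t\<bar> \<le> K1 + K2" if "\<bar>s\<bar> \<le> K1" "\<bar>t\<bar> \<le> K2" for s t :: real
    using that by linarith
  show ?thesis
  proof (rule bounded_convI[where X = "X1 \<union> X2" and K = "K1 + K2"])
    show "\<forall>\<^sub>F d in at_top. (\<lambda>u. F d u + G d u) \<in> borel_measurable borel"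
      using F(2) G(2) by eventually_elim measurable
    show "\<forall>\<^sub>F d in at_top. \<forall>u\<in>{0..2*pi}. \<bar>F d u + G d u\<bar> \<le> K1 + K2"
      using F(3) G(3) by eventually_elim (auto intro!: bnd)
  qed (use F(1,4,5) G(1,4,5) in \<open>auto intro!: tendsto_intros\<close>)
qed

lemma bounded_conv_mult:
  assumes "bounded_conv F f" "bounded_conv G g"
  shows "bounded_conv (\<lambda>d u. F d u * G d u) (\<lambda>u. f u * g u)"
proof -
  obtain K1 X1 where F: "f \<in> borel_measurable borel"
      "\<forall>\<^sub>F d in at_top. F d \<in> borel_measurable borel"
      "\<forall>\<^sub>F d in at_top. \<forall>u\<in>{0..2*pi}. \<bar>F d u\<bar> \<le> K1"
      "finite X1" "\<And>u. u \<in> {0..2*pi} \<Longrightarrow> u \<notin> X1 \<Longrightarrow> ((\<lambda>d. F d u) \<longlongrightarrow> f u) at_top"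
    by (rule bounded_convE[OF assms(1)]; rule that)
  obtain K2 X2 where G: "g \<in> borel_measurable borel"
      "\<forall>\<^sub>F d in at_top. G d \<in> borel_measurable borel"
      "\<forall>\<^sub>F d in at_top. \<forall>u\<in>{0..2*pi}. \<bar>G d u\<bar> \<le> K2"
      "finite X2" "\<And>u. u \<in> {0..2*pi} \<Longrightarrow> u \<notin> X2 \<Longrightarrow> ((\<lambda>d. G d u) \<longlongrightarrow> g u) at_top"
    by (rule bounded_convE[OF assms(2)]; rule that)
  have bnd: "\<bar>s * t\<bar> \<le> K1 * K2" if "\<bar>s\<bar> \<le> K1" "\<bar>t\<bar> \<le> K2" for s t :: real
    unfolding abs_mult using that by (intro mult_mono) auto
  show ?thesis
  proof (rule bounded_convI[where X = "X1 \<union> X2" and K = "K1 * K2"])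
    show "\<forall>\<^sub>F d in at_top. (\<lambda>u. F d u * G d u) \<in> borel_measurable borel"
      using F(2) G(2) by eventually_elim measurable
    show "\<forall>\<^sub>F d in at_top. \<forall>u\<in>{0..2*pi}. \<bar>F d u * G d u\<bar> \<le> K1 * K2"
      using F(3) G(3) by eventually_elim (auto intro!: bnd)
  qed (use F(1,4,5) G(1,4,5) in \<open>auto intro!: tendsto_intros\<close>)
qed

lemma bounded_conv_cmult:
  "bounded_conv F f \<Longrightarrow> bounded_conv (\<lambda>d u. c * F d u) (\<lambda>u. c * f u)"
  by (rule bounded_conv_mult[OF bounded_conv_scalar[OF tendsto_const]])

lemma bounded_conv_uminus:
  "bounded_conv F f \<Longrightarrow> bounded_conv (\<lambda>d u. - F d u) (\<lambda>u. - f u)"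
  using bounded_conv_cmult[of F f "-1"] by simp

lemma bounded_conv_diff:
  "bounded_conv F f \<Longrightarrow> bounded_conv G g \<Longrightarrow> bounded_conv (\<lambda>d u. F d u - G d u) (\<lambda>u. f u - g u)"
  using bounded_conv_add[OF _ bounded_conv_uminus] by fastforce

lemma tendsto_set_lebesgue_integral:
  assumes "bounded_conv F f"
  shows "((\<lambda>d. LINT u:{0..2*pi}|lebesgue. F d u) \<longlongrightarrow> (LINT u:{0..2*pi}|lebesgue. f u)) at_top"
proof -
  obtain K X where F: "f \<in> borel_measurable borel"
      "\<forall>\<^sub>F d in at_top. F d \<in> borel_measurable borel"
      "\<forall>\<^sub>F d in at_top. \<forall>u\<in>{0..2*pi}. \<bar>F d u\<bar> \<le> K"
      "finite X" "\<And>u. u \<in> {0..2*pi} \<Longrightarrow> u \<notin> X \<Longrightarrow> ((\<lambda>d. F d u) \<longlongrightarrow> f u) at_top"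
    by (rule bounded_convE[OF assms]; rule that)
  \<comment> \<open>The dominated convergence rule wants measurability for every \<open>d\<close>,
    whereas it is known only eventually; zero fills in elsewhere.\<close>
  define F' where "F' d = (if F d \<in> borel_measurable borel then F d else (\<lambda>u. 0))" for d
  have F': "\<forall>\<^sub>F d in at_top. F d = F' d"
    using F(2) by eventually_elim (simp add: F'_def)
  have [measurable]: "F' d \<in> borel_measurable borel" for d
    by (cases "F d \<in> borel_measurable borel") (simp_all add: F'_def)
  note F(1) [measurable]
  have "((\<lambda>d. integral\<^sup>L lebesgue (\<lambda>u. indicator {0..2*pi} u *\<^sub>R F' d u)) \<longlongrightarrow>
      integral\<^sup>L lebesgue (\<lambda>u. indicator {0..2*pi} u *\<^sub>R f u)) at_top"
  proof (rule integral_dominated_convergence_at_top)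
    show "integrable lebesgue (\<lambda>u. indicator {0..2*pi} u * K)"
      by (simp add: lmeasurable_iff_integrable[symmetric])
    have "AE u in lebesgue. u \<notin> X"
      using F(4) by (intro AE_not_in) (simp add: negligible_finite flip: negligible_iff_null_sets)
    then show "AE u in lebesgue. ((\<lambda>d. indicator {0..2*pi} u *\<^sub>R F' d u)
        \<longlongrightarrow> indicator {0..2*pi} u *\<^sub>R f u) at_top"
    proof eventually_elim
      case (elim u)
      show ?case
      proof (cases "u \<in> {0..2*pi}")
        case True
        have "\<forall>\<^sub>F d in at_top. F d u = F' d u"
          using F' by eventually_elim simp
        then show ?thesis
          using Lim_transform_eventually[OF F(5)] True elim by simp
      qed simp
    qed
    show "\<forall>\<^sub>F d in at_top. AE u in lebesgue. norm (indicator {0..2*pi} u *\<^sub>R F' d u)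
        \<le> indicator {0..2*pi} u * K"
      using F(2,3) by eventually_elim (simp add: F'_def indicator_def)
  qed (auto intro!: measurable_completion)
  moreover have "\<forall>\<^sub>F d in at_top. integral\<^sup>L lebesgue (\<lambda>u. indicator {0..2*pi} u *\<^sub>R F' d u)
      = (LINT u:{0..2*pi}|lebesgue. F d u)"
    using F' by eventually_elim (simp add: set_lebesgue_integral_def)
  ultimately show ?thesis
    unfolding set_lebesgue_integral_def[of _ _ f] by (rule Lim_transform_eventually)
qed

lemma set_integrable_bounded_borel:
  fixes f :: "real \<Rightarrow> real"
  assumes f: "f \<in> borel_measurable borel" and K: "\<And>u. u \<in> {0..2*pi} \<Longrightarrow> \<bar>f u\<bar> \<le> K"
  shows "set_integrable lebesgue {0..2*pi} f"
proof -
  have "integrable lebesgue (\<lambda>u. indicator {0..2*pi} u * K)"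
    by (simp add: lmeasurable_iff_integrable[symmetric])
  then show ?thesis
    unfolding set_integrable_def
  proof (rule Bochner_Integration.integrable_bound)
    show "AE u in lebesgue. norm (indicator {0..2*pi} u *\<^sub>R f u) \<le> norm (indicator {0..2*pi} u * K)"
      by (intro AE_I2) (auto simp: indicator_def intro: order_trans[OF K abs_ge_self])
  qed (use f in \<open>auto intro!: measurable_completion\<close>)
qed

subsection \<open>The integrands at finite distance\<close>

lemma norm_divide_sgn_le: "cmod (z / sgn y) \<le> cmod z"
  by (cases "y = 0") (simp_all add: norm_divide norm_sgn)

lemma borel_measurable_sgn [measurable (raw)]:
  fixes f :: "'a \<Rightarrow> complex"
  assumes "f \<in> borel_measurable M"
  shows "(\<lambda>x. sgn (f x)) \<in> borel_measurable M"
  unfolding sgn_div_norm using assms by measurable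

text \<open>At \<open>z = cis x\<close> the imaginary part is the sine and the real part the cosine,
  so this and \<open>lambert_v\<close> are the weights \<open>w\<close> and \<open>v\<close> without
  a choice of branch for the angle.\<close>

definition lambert_w :: "real \<Rightarrow> complex \<Rightarrow> real" where
  "lambert_w \<alpha> z = max (Im z) 0 powr (\<alpha> + 1)"

definition lambert_v :: "real \<Rightarrow> complex \<Rightarrow> real" where
  "lambert_v \<alpha> z = max (Im z) 0 powr \<alpha> * Re z"

locale extended_target =
  fixes Q :: nat and a b :: "nat \<Rightarrow> real" and \<phi>0 \<psi> \<alpha> :: real
  assumes Q: "1 \<le> Q" and a1: "0 < a 1" and b1: "0 < b 1" and roughness: "0 \<le> \<alpha>"
begin

definition par :: "real \<Rightarrow> nat \<Rightarrow> real" where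
  "par d = param Q d \<phi>0 \<psi> a b"

text \<open>\<open>rho\<close> does not read the distance entry, so \<open>par 0\<close> stands for
  every \<open>par d\<close> here and below.\<close>

definition shape :: "real \<Rightarrow> complex" where
  "shape u = cis \<psi> * rho Q (par 0) u"

definition tang :: "real \<Rightarrow> complex" where
  "tang u = cis \<psi> * rho_dot Q (par 0) u"

definition point :: "real \<Rightarrow> real \<Rightarrow> complex" where
  "point d u = of_real d * cis \<phi>0 + shape u"

lemma par_simps [simp]: "par d 1 = d" "par d (Suc 0) = d" "par d 2 = \<phi>0" "par d 3 = \<psi>"
  by (simp_all add: par_def param_def)

lemma rho_par: "rho Q (par d) u = Complex (\<Sum>k=1..Q. a k * cos (real k * u)) (\<Sum>k=1..Q. b k * sin (real k * u))"
  by (auto simp: rho_def par_def param_def intro!: sum.cong)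

lemma rho_dot_par: "rho_dot Q (par d) u = Complex (\<Sum>k=1..Q. - (real k * a k * sin (real k * u)))
    (\<Sum>k=1..Q. real k * b k * cos (real k * u))"
  by (auto simp: rho_dot_def par_def param_def intro!: sum.cong)

lemma contour_par: "contour Q (par d) u = point d u"
  by (simp add: contour_eq point_def shape_def rho_par)

lemma contour_dot_par: "contour_dot Q (par d) u = tang u"
  by (simp add: contour_dot_eq tang_def rho_dot_par)

text \<open>The tangent, and with it the weight of the star product, is independent of the distance.
  As \<open>d\<close> grows only the integrands move, inside one fixed inner product.\<close>

lemma star_prod_par: "star_prod Q (par d) = star_prod Q (par 0)"
  unfolding star_prod_def contour_dot_par by (rule refl)

lemma proj_perp_par: "proj_perp Q (par d) = proj_perp Q (par 0)"
  unfolding proj_perp_def star_prod_par[of d] by (rule refl)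

lemma has_vector_derivative_shape: "(shape has_vector_derivative tang u) (at u)"
  unfolding shape_def tang_def by (intro derivative_intros has_vector_derivative_rho)

lemma continuous_on_shape: "continuous_on S shape"
  using has_vector_derivative_continuous[OF has_vector_derivative_shape]
  by (auto intro: continuous_at_imp_continuous_on)

lemma continuous_on_tang: "continuous_on S tang"
  unfolding tang_def rho_dot_par by (intro continuous_intros)

lemma shape_measurable [measurable]: "shape \<in> borel_measurable borel"
  by (intro borel_measurable_continuous_onI continuous_on_shape)

lemma tang_measurable [measurable]: "tang \<in> borel_measurable borel"
  by (intro borel_measurable_continuous_onI continuous_on_tang)

lemma point_measurable [measurable]: "point d \<in> borel_measurable borel"
  unfolding point_def by measurable

lemma shape_bounded:
  obtains K where "0 \<le> K" "\<And>u. u \<in> {0..2*pi} \<Longrightarrow> cmod (shape u) \<le> K"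
proof -
  have "bounded (shape ` {0..2*pi})"
    by (intro compact_imp_bounded compact_continuous_image continuous_on_shape) simp
  then show thesis
    using that unfolding bounded_pos by (metis image_eqI less_imp_le)
qed

lemma tang_bounded:
  obtains K where "\<And>u. u \<in> {0..2*pi} \<Longrightarrow> cmod (tang u) \<le> K"
proof -
  have "bounded (tang ` {0..2*pi})"
    by (intro compact_imp_bounded compact_continuous_image continuous_on_tang) simp
  then show thesis
    using that unfolding bounded_pos by (metis image_eqI)
qed

text \<open>The first harmonic has coefficients \<open>Re y * a 1\<close> and
  \<open>- Im y * b 1\<close>, which cannot both vanish since \<open>y\<close> is nonzero and
  \<open>a 1\<close>, \<open>b 1\<close> are positive. Every real linear functional of the contour
  is therefore nonconstant.\<close>

lemma finite_shape_level:
  assumes "z \<noteq> 0"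
  shows "finite {u \<in> {0..2*pi}. Re (z * shape u) = \<kappa>}"
proof -
  define y where "y = z * cis \<psi>"
  have "y \<noteq> 0"
    using assms by (simp add: y_def)
  then have y: "Re y \<noteq> 0 \<or> Im y \<noteq> 0"
    by (simp add: complex_eq_iff)
  have "Re (z * shape u) = (\<Sum>k=1..Q. (Re y * a k) * cos (real k * u) + (- Im y * b k) * sin (real k * u))" for u
  proof -
    have "Re (z * shape u) = Re (y * rho Q (par 0) u)"
      by (simp add: shape_def y_def mult.assoc)
    then show ?thesis
      by (simp add: rho_par sum.distrib sum_distrib_left sum_negf mult.assoc sum_subtractf)
  qed
  then show ?thesis
    using finite_trig_level_set[OF Q, of "\<lambda>k. Re y * a k" "\<lambda>k. - Im y * b k"] y a1 b1 by simp
qed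

lemma finite_tang_level:
  assumes "z \<noteq> 0"
  shows "finite {u \<in> {0..2*pi}. Re (z * tang u) = \<kappa>}"
proof -
  define y where "y = z * cis \<psi>"
  have "y \<noteq> 0"
    using assms by (simp add: y_def)
  then have y: "Re y \<noteq> 0 \<or> Im y \<noteq> 0"
    by (simp add: complex_eq_iff)
  have "Re (z * tang u) = (\<Sum>k=1..Q. (- Im y * real k * b k) * cos (real k * u)
      + (- Re y * real k * a k) * sin (real k * u))" for u
  proof -
    have "Re (z * tang u) = Re (y * rho_dot Q (par 0) u)"
      by (simp add: tang_def y_def mult.assoc)
    then show ?thesis
      by (simp add: rho_dot_par sum.distrib sum_distrib_left sum_negf mult.assoc sum_subtractf)
  qed
  then show ?thesis
    using finite_trig_level_set[OF Q, of "\<lambda>k. - Im y * real k * b k" "\<lambda>k. - Re y * real k * a k"] y a1 b1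
    by auto
qed

text \<open>The whole real axis, not just the cut of \<open>Arg\<close>, is taken: this makes the
  set a union of two level sets and also covers the zeros of contour and tangent.\<close>

definition axis_hits :: "real \<Rightarrow> real set" where
  "axis_hits d = {u \<in> {0..2*pi}. Im (point d u) = 0 \<or> Im (tang u) = 0}"

lemma finite_axis_hits: "finite (axis_hits d)"
proof -
  have "axis_hits d = {u \<in> {0..2*pi}. Re (- \<i> * shape u) = - d * sin \<phi>0} \<union> {u \<in> {0..2*pi}. Re (- \<i> * tang u) = 0}"
    by (auto simp: axis_hits_def point_def)
  then show ?thesis
    using finite_shape_level[of "- \<i>"] finite_tang_level[of "- \<i>"] by simp
qed

lemma off_axis:
  assumes "u \<in> {0..2*pi}" "u \<notin> axis_hits d"
  shows "point d u \<notin> \<real>\<^sub>\<le>\<^sub>0" "tang u \<notin> \<real>\<^sub>\<le>\<^sub>0" "point d u \<noteq> 0" "tang u \<noteq> 0"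
  using assms by (auto simp: axis_hits_def complex_nonpos_Reals_iff)

text \<open>Off \<open>axis_hits\<close> this is \<open>cis (phi - beta)\<close>. Because
  \<open>sgn 0 = 0\<close>, its modulus is at most 1 even where contour or tangent vanishes.\<close>

definition view :: "real \<Rightarrow> real \<Rightarrow> complex" where
  "view d u = sgn (point d u) / sgn (tang u)"

definition view_inf :: "real \<Rightarrow> complex" where
  "view_inf u = cis \<phi>0 / sgn (tang u)"

lemma cis_phi_beta:
  assumes "u \<in> {0..2*pi}" "u \<notin> axis_hits d"
  shows "cis (phi Q (par d) u - beta Q (par d) u) = view d u"
  using off_axis[OF assms]
  by (simp add: phi_def beta_def contour_par contour_dot_par view_def cis_Arg flip: cis_divide)

definition w_par :: "real \<Rightarrow> real \<Rightarrow> real" where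
  "w_par d u = lambert_w \<alpha> (view d u)"

definition v_par :: "real \<Rightarrow> real \<Rightarrow> real" where
  "v_par d u = lambert_v \<alpha> (view d u)"

definition w_inf :: "real \<Rightarrow> real" where
  "w_inf u = lambert_w \<alpha> (view_inf u)"

definition v_inf :: "real \<Rightarrow> real" where
  "v_inf u = lambert_v \<alpha> (view_inf u)"

lemma w_fun_par: "eq_off_finite (w_fun \<alpha> Q (par d)) (w_par d)"
  using cis_phi_beta[of _ d, symmetric]
  by (intro eq_off_finiteI[OF finite_axis_hits[of d]])
    (simp add: w_fun_def w_par_def lambert_w_def sin_plus_def)

lemma v_fun_par: "eq_off_finite (v_fun \<alpha> Q (par d)) (v_par d)"
  using cis_phi_beta[of _ d, symmetric]
  by (intro eq_off_finiteI[OF finite_axis_hits[of d]])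
    (simp add: v_fun_def v_par_def lambert_v_def sin_plus_def)

lemma cos_phi_eq: "eq_off_finite (\<lambda>u. cos (phi Q (par d) u)) (\<lambda>u. Re (sgn (point d u)))"
  using off_axis(3)[of _ d] cis_Arg[symmetric]
  by (intro eq_off_finiteI[OF finite_axis_hits[of d]]) (simp add: phi_def contour_par)

text \<open>Writing \<open>cmod r * (x / r)\<close> as \<open>x / sgn r\<close> gives bounds that
  are uniform in \<open>d\<close> and survive zeros of \<open>point d\<close>. The last branch is
  the orientation entry.\<close>

definition mu_par :: "real \<Rightarrow> nat \<Rightarrow> real \<Rightarrow> real" where
  "mu_par d i u = (if i = 1 then Re (cis \<phi>0 / sgn (point d u)) else
     if i = 2 then Im (shape u / sgn (point d u)) else - Im (shape u / sgn (point d u)))"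

definition eta_par :: "real \<Rightarrow> nat \<Rightarrow> real \<Rightarrow> real" where
  "eta_par d i u = (if i = 1 then Im (cis \<phi>0 / point d u) else
     if i = 2 then 1 - Re (shape u / point d u) else Re (shape u / point d u))"

definition xi_par :: "real \<Rightarrow> nat \<Rightarrow> real \<Rightarrow> real" where
  "xi_par d i u = (if i = 1 then Im (cis \<phi>0 / point d u) else
     if i = 2 then 1 - Re (shape u / point d u) else - (1 - Re (shape u / point d u)))"

lemma cmod_times_divide: "cmod z * Re (x / z) = Re (x / sgn z)" "cmod z * Im (x / z) = Im (x / sgn z)"
proof -
  have "x / sgn z = of_real (cmod z) * (x / z)"
    by (cases "z = 0") (simp_all add: sgn_eq)
  then show "cmod z * Re (x / z) = Re (x / sgn z)" "cmod z * Im (x / z) = Im (x / sgn z)"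
    by (simp_all only: times_complex.sel Re_complex_of_real Im_complex_of_real mult_zero_left
        diff_zero add_0_right)
qed

lemma mu_par_eq: "i \<in> {1,2,3} \<Longrightarrow> eq_off_finite (mu Q (par d) i) (mu_par d i)"
  using off_axis(3)[of _ d] mu_eq[of Q "par d"]
  by (intro eq_off_finiteI[OF finite_axis_hits[of d]])
    (auto simp: mu_par_def contour_par cmod_times_divide shape_def rho_par)

lemma eta_par_eq: "i \<in> {1,2,3} \<Longrightarrow> eq_off_finite (eta Q (par d) i) (eta_par d i)"
  using off_axis(1)[of _ d] eta_eq[of Q "par d"]
  by (intro eq_off_finiteI[OF finite_axis_hits[of d]])
    (auto simp: eta_par_def contour_par shape_def rho_par)

lemma xi_par_eq: "i \<in> {1,2,3} \<Longrightarrow> eq_off_finite (xi Q (par d) i) (xi_par d i)"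
  using off_axis(1,2)[of _ d] xi_eq[of Q "par d"]
  by (intro eq_off_finiteI[OF finite_axis_hits[of d]])
    (auto simp: xi_par_def contour_par contour_dot_par shape_def rho_par)

end

subsection \<open>The far-field limit\<close>

lemma lambert_w_bound:
  assumes "0 \<le> \<alpha>" "cmod z \<le> 1"
  shows "\<bar>lambert_w \<alpha> z\<bar> \<le> 1"
proof -
  have "max (Im z) 0 \<le> 1"
    using assms(2) abs_Im_le_cmod[of z] by linarith
  then show ?thesis
    using assms(1) by (simp add: lambert_w_def powr_le1)
qed

lemma lambert_v_bound:
  assumes "0 \<le> \<alpha>" "cmod z \<le> 1"
  shows "\<bar>lambert_v \<alpha> z\<bar> \<le> 1"
proof -
  have "max (Im z) 0 \<le> 1" "\<bar>Re z\<bar> \<le> 1"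
    using assms(2) abs_Im_le_cmod[of z] abs_Re_le_cmod[of z] by linarith+
  then have "max (Im z) 0 powr \<alpha> * \<bar>Re z\<bar> \<le> 1 * 1"
    using assms(1) by (intro mult_mono powr_le1) auto
  then show ?thesis
    by (simp add: lambert_v_def abs_mult)
qed

text \<open>The exponent \<open>\<alpha> + 1\<close> is positive, so the power is continuous also at
  grazing incidence, where its base is zero.\<close>

lemma tendsto_lambert_w:
  assumes "0 \<le> \<alpha>" "(f \<longlongrightarrow> z) F"
  shows "((\<lambda>x. lambert_w \<alpha> (f x)) \<longlongrightarrow> lambert_w \<alpha> z) F"
  unfolding lambert_w_def using assms(1)
  by (intro tendsto_powr' tendsto_intros tendsto_Im assms(2)) auto

text \<open>For \<alpha> = 0 the power is the indicator of \<open>0 < Im z\<close>, which jumps at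
  \<open>Im z = 0\<close>. Away from there the function is either continuous or eventually
  zero.\<close>

lemma tendsto_lambert_v:
  assumes f: "(f \<longlongrightarrow> z) F" and z: "Im z \<noteq> 0"
  shows "((\<lambda>x. lambert_v \<alpha> (f x)) \<longlongrightarrow> lambert_v \<alpha> z) F"
proof (cases "0 < Im z")
  case True
  then show ?thesis
    unfolding lambert_v_def by (intro tendsto_intros f tendsto_powr) auto
next
  case False
  then have "Im z < 0"
    using z by simp
  then have "\<forall>\<^sub>F x in F. Im (f x) < 0"
    using order_tendstoD(2)[OF tendsto_Im[OF f]] by blast
  then have "\<forall>\<^sub>F x in F. 0 = lambert_v \<alpha> (f x)"
    by eventually_elim (simp add: lambert_v_def)
  moreover have "lambert_v \<alpha> z = 0"
    using \<open>Im z < 0\<close> by (simp add: lambert_v_def)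
  ultimately show ?thesis
    using Lim_transform_eventually[OF tendsto_const] by metis
qed

lemma lambert_w_measurable [measurable (raw)]:
  "f \<in> borel_measurable M \<Longrightarrow> (\<lambda>x. lambert_w \<alpha> (f x)) \<in> borel_measurable M"
  unfolding lambert_w_def by measurable

lemma lambert_v_measurable [measurable (raw)]:
  assumes [measurable]: "f \<in> borel_measurable M"
  shows "(\<lambda>x. lambert_v \<alpha> (f x)) \<in> borel_measurable M"
proof -
  have [measurable]: "(\<lambda>x. Re (f x)) \<in> borel_measurable M" "(\<lambda>x. Im (f x)) \<in> borel_measurable M"
    using assms by (simp_all add: borel_measurable_complex_iff)
  show ?thesis
    unfolding lambert_v_def by measurable
qed

context extended_target
begin

lemma view_measurable [measurable]: "view d \<in> borel_measurable borel"
  unfolding view_def by measurable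

lemma view_inf_measurable [measurable]: "view_inf \<in> borel_measurable borel"
  unfolding view_inf_def by measurable

lemma norm_view_le: "cmod (view d u) \<le> 1" "cmod (view_inf u) \<le> 1"
  by (auto simp: view_def view_inf_def norm_divide norm_sgn)

text \<open>A positive factor \<open>d\<close> drops out of \<open>sgn\<close> and supplies the
  decay of order \<open>1 / d\<close> in quotients by \<open>point d u\<close>; the other factor
  tends to \<open>cis \<phi>0\<close>.\<close>

lemma point_scaled:
  "0 < d \<Longrightarrow> point d u = of_real d * (cis \<phi>0 + of_real (inverse d) * shape u)"
  by (simp add: point_def distrib_left flip: mult.assoc of_real_mult)

lemma tendsto_scaled_point:
  "((\<lambda>d. cis \<phi>0 + of_real (inverse d) * shape u) \<longlongrightarrow> cis \<phi>0) at_top"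
proof -
  have "((\<lambda>d. cis \<phi>0 + of_real (inverse d) * shape u) \<longlongrightarrow> cis \<phi>0 + of_real 0 * shape u) at_top"
    by (intro tendsto_intros tendsto_inverse_0_at_top filterlim_ident)
  then show ?thesis
    by simp
qed

lemma tendsto_sgn_point: "((\<lambda>d. sgn (point d u)) \<longlongrightarrow> cis \<phi>0) at_top"
proof -
  have "((\<lambda>d. sgn (cis \<phi>0 + of_real (inverse d) * shape u)) \<longlongrightarrow> sgn (cis \<phi>0)) at_top"
    by (intro tendsto_sgn tendsto_scaled_point) simp
  moreover have "\<forall>\<^sub>F d in at_top. sgn (cis \<phi>0 + of_real (inverse d) * shape u) = sgn (point d u)"
    using eventually_gt_at_top[of 0]
    by eventually_elim (simp add: point_scaled sgn_mult sgn_of_real)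
  ultimately have "((\<lambda>d. sgn (point d u)) \<longlongrightarrow> sgn (cis \<phi>0)) at_top"
    by (rule Lim_transform_eventually)
  then show ?thesis
    by (simp add: sgn_div_norm)
qed

lemma tendsto_divide_point: "((\<lambda>d. z / point d u) \<longlongrightarrow> 0) at_top"
proof -
  have "((\<lambda>d. of_real (inverse d) * (z / (cis \<phi>0 + of_real (inverse d) * shape u)))
      \<longlongrightarrow> of_real 0 * (z / cis \<phi>0)) at_top"
    by (intro tendsto_mult tendsto_of_real tendsto_inverse_0_at_top filterlim_ident
        tendsto_divide tendsto_const tendsto_scaled_point) simp
  moreover have "\<forall>\<^sub>F d in at_top. of_real (inverse d) * (z / (cis \<phi>0 + of_real (inverse d) * shape u))
      = z / point d u"
    using eventually_gt_at_top[of 0]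
    by eventually_elim (simp add: point_scaled divide_inverse)
  ultimately have "((\<lambda>d. z / point d u) \<longlongrightarrow> of_real 0 * (z / cis \<phi>0)) at_top"
    by (rule Lim_transform_eventually)
  then show ?thesis
    by simp
qed

text \<open>Uniformity in \<open>u\<close> is the point: it turns the quotients by
  \<open>point d u\<close> into uniformly bounded functions. Any positive constant would serve as
  well as 1.\<close>

lemma eventually_point_far: "\<forall>\<^sub>F d in at_top. \<forall>u\<in>{0..2*pi}. 1 \<le> cmod (point d u)"
proof -
  obtain K where K: "\<And>u. u \<in> {0..2*pi} \<Longrightarrow> cmod (shape u) \<le> K"
    using shape_bounded by metis
  show ?thesis
    using eventually_ge_at_top[of "K + 1"] eventually_ge_at_top[of 0]
  proof eventually_elim
    case (elim d)
    show ?case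
    proof
      fix u :: real
      assume u: "u \<in> {0..2*pi}"
      have "cmod (of_real d * cis \<phi>0) \<le> cmod (point d u) + cmod (shape u)"
        unfolding point_def by (metis add_diff_cancel norm_triangle_ineq4)
      then show "1 \<le> cmod (point d u)"
        using K[OF u] elim by (simp add: norm_mult)
    qed
  qed
qed

lemma tendsto_view: "((\<lambda>d. view d u) \<longlongrightarrow> view_inf u) at_top"
  unfolding view_def view_inf_def divide_inverse by (intro tendsto_intros tendsto_sgn_point)

text \<open>Multiplying by the speed replaces the unit tangent by the tangent itself, so visibility
  becomes the sign of a trigonometric polynomial. At a zero of the tangent both sides
  vanish.\<close>

lemma Im_view_inf: "cmod (tang u) * Im (view_inf u) = Im (cis \<phi>0 * cnj (tang u))"
proof -
  have "of_real (cmod (tang u)) * view_inf u = cis \<phi>0 * cnj (tang u)"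
  proof (cases "tang u = 0")
    case False
    then have "view_inf u = cis \<phi>0 * cnj (sgn (tang u))"
      unfolding view_inf_def by (subst complex_div_cnj) (simp add: norm_sgn)
    then show ?thesis
      using False by (simp add: sgn_eq)
  qed simp
  then have "Im (of_real (cmod (tang u)) * view_inf u) = Im (cis \<phi>0 * cnj (tang u))"
    by (rule arg_cong)
  then show ?thesis
    by (simp only: times_complex.sel Re_complex_of_real Im_complex_of_real mult_zero_left add_0_right)
qed

text \<open>The excluded arguments for the convergence of \<open>v_par\<close>: there the limit line
  of sight is tangent to the contour, or the tangent vanishes.\<close>

lemma finite_grazing: "finite {u \<in> {0..2*pi}. Im (view_inf u) = 0}"
proof -
  have "Re (\<i> * cnj (cis \<phi>0) * tang u) = 0" if "Im (view_inf u) = 0" for u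
    using Im_view_inf[of u] that by (simp add: algebra_simps)
  then have "{u \<in> {0..2*pi}. Im (view_inf u) = 0}
      \<subseteq> {u \<in> {0..2*pi}. Re (\<i> * cnj (cis \<phi>0) * tang u) = 0}"
    by blast
  then show ?thesis
    by (rule finite_subset) (intro finite_tang_level, simp)
qed

lemma bounded_conv_w_par: "bounded_conv w_par w_inf"
  unfolding w_par_def[abs_def] w_inf_def[abs_def]
proof (rule bounded_convI[where X = "{}" and K = 1])
  show "((\<lambda>d. lambert_w \<alpha> (view d u)) \<longlongrightarrow> lambert_w \<alpha> (view_inf u)) at_top" for u
    by (intro tendsto_lambert_w roughness tendsto_view)
qed (use roughness norm_view_le in \<open>auto intro!: always_eventually lambert_w_bound\<close>)

lemma bounded_conv_v_par: "bounded_conv v_par v_inf"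
  unfolding v_par_def[abs_def] v_inf_def[abs_def]
proof (rule bounded_convI[OF _ _ _ finite_grazing, where K = 1])
  show "((\<lambda>d. lambert_v \<alpha> (view d u)) \<longlongrightarrow> lambert_v \<alpha> (view_inf u)) at_top"
    if "u \<in> {0..2*pi}" "u \<notin> {u \<in> {0..2*pi}. Im (view_inf u) = 0}" for u
    using that by (intro tendsto_lambert_v tendsto_view) auto
qed (use roughness norm_view_le in \<open>auto intro!: always_eventually lambert_v_bound\<close>)

text \<open>The coordinate of the contour point across the line of sight, measured from the centre;
  by \<open>cross_range_par\<close> it is \<open>cross_range\<close> at every positive
  distance.\<close>

definition cross :: "real \<Rightarrow> real" where
  "cross u = Im (shape u / cis \<phi>0)"

text \<open>In the far field the range reacts to the distance and, through \<open>cross\<close>, to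
  bearing minus orientation; the polar angle reacts to the bearing only (\<open>eta_inf\<close>),
  and \<open>phi - beta\<close> to bearing minus orientation (\<open>xi_inf\<close>).\<close>

definition mu_inf :: "nat \<Rightarrow> real \<Rightarrow> real" where
  "mu_inf i u = (if i = 1 then 1 else if i = 2 then cross u else - cross u)"

definition eta_inf :: "nat \<Rightarrow> real \<Rightarrow> real" where
  "eta_inf i u = (if i = 2 then 1 else 0)"

definition xi_inf :: "nat \<Rightarrow> real \<Rightarrow> real" where
  "xi_inf i u = (if i = 1 then 0 else if i = 2 then 1 else - 1)"

lemma cross_measurable [measurable]: "cross \<in> borel_measurable borel"
  unfolding cross_def by measurable

lemma bounded_conv_shape_sgn:
  "bounded_conv (\<lambda>d u. Im (shape u / sgn (point d u))) cross"
proof -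
  obtain K where K: "\<And>u. u \<in> {0..2*pi} \<Longrightarrow> cmod (shape u) \<le> K"
    using shape_bounded by metis
  show ?thesis
  proof (rule bounded_convI[where X = "{}" and K = K])
    show "\<forall>\<^sub>F d in at_top. \<forall>u\<in>{0..2*pi}. \<bar>Im (shape u / sgn (point d u))\<bar> \<le> K"
      by (intro always_eventually allI ballI order_trans[OF abs_Im_le_cmod]
          order_trans[OF norm_divide_sgn_le] K)
    show "((\<lambda>d. Im (shape u / sgn (point d u))) \<longlongrightarrow> cross u) at_top" for u
      unfolding cross_def by (intro tendsto_intros tendsto_sgn_point) simp
  qed auto
qed

lemma bounded_conv_mu: "bounded_conv (\<lambda>d. mu_par d i) (mu_inf i)"
proof -
  have "bounded_conv (\<lambda>d u. Re (cis \<phi>0 / sgn (point d u))) (\<lambda>u. 1)"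
  proof (rule bounded_convI[where X = "{}" and K = 1])
    show "\<forall>\<^sub>F d in at_top. \<forall>u\<in>{0..2*pi}. \<bar>Re (cis \<phi>0 / sgn (point d u))\<bar> \<le> 1"
      using order_trans[OF abs_Re_le_cmod norm_divide_sgn_le[of "cis \<phi>0"]]
      by (intro always_eventually) simp
    have "((\<lambda>d. Re (cis \<phi>0 / sgn (point d u))) \<longlongrightarrow> Re (cis \<phi>0 / cis \<phi>0)) at_top" for u
      by (intro tendsto_intros tendsto_sgn_point) simp
    then show "((\<lambda>d. Re (cis \<phi>0 / sgn (point d u))) \<longlongrightarrow> 1) at_top" for u
      by simp
  qed auto
  then show ?thesis
    unfolding mu_par_def[abs_def] mu_inf_def[abs_def]
    using bounded_conv_shape_sgn bounded_conv_uminus[OF bounded_conv_shape_sgn]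
    by (cases "i = 1"; cases "i = 2") simp_all
qed

text \<open>A fixed displacement of a remote point changes its polar angle by an amount of order
  \<open>1 / d\<close>. This accounts for all vanishing terms in \<open>eta_par\<close> and
  \<open>xi_par\<close>.\<close>

lemma bounded_conv_divide_point:
  assumes f: "f \<in> {\<lambda>u. cis \<phi>0, shape}"
    and h: "h \<in> {Re, Im}"
  shows "bounded_conv (\<lambda>d u. h (f u / point d u)) (\<lambda>u. 0)"
proof -
  obtain K where K0: "0 \<le> K" and K: "\<And>u. u \<in> {0..2*pi} \<Longrightarrow> cmod (shape u) \<le> K"
    using shape_bounded by metis
  have f_bound: "cmod (f u) \<le> K + 1" if "u \<in> {0..2*pi}" for u
    using f K[OF that] K0 by auto
  have h_bound: "\<bar>h z\<bar> \<le> cmod z" for z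
    using h abs_Re_le_cmod abs_Im_le_cmod by auto
  have bound: "\<bar>h (f u / point d u)\<bar> \<le> K + 1"
    if "u \<in> {0..2*pi}" "1 \<le> cmod (point d u)" for d u
  proof -
    have "\<bar>h (f u / point d u)\<bar> \<le> cmod (f u) / cmod (point d u)"
      using h_bound by (simp flip: norm_divide)
    also have "\<dots> \<le> cmod (f u) / 1"
      using that(2) by (intro divide_left_mono) auto
    finally show ?thesis
      using f_bound[OF that(1)] by simp
  qed
  have meas: "f \<in> borel_measurable borel" "h \<in> borel_measurable borel"
    using f h by auto
  show ?thesis
  proof (rule bounded_convI[where X = "{}" and K = "K + 1"])
    show "\<forall>\<^sub>F d in at_top. \<forall>u\<in>{0..2*pi}. \<bar>h (f u / point d u)\<bar> \<le> K + 1"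
      using eventually_point_far by eventually_elim (use bound in blast)
    have "((\<lambda>d. h (f u / point d u)) \<longlongrightarrow> h 0) at_top" for u
      using h tendsto_Re[OF tendsto_divide_point[of "f u" u]] tendsto_Im[OF tendsto_divide_point[of "f u" u]]
      by auto
    then show "((\<lambda>d. h (f u / point d u)) \<longlongrightarrow> 0) at_top" for u
      using h by auto
  qed (use meas in auto)
qed

lemma bounded_conv_eta: "bounded_conv (\<lambda>d. eta_par d i) (eta_inf i)"
proof -
  have *: "bounded_conv (\<lambda>d u. 1 - Re (shape u / point d u)) (\<lambda>u. 1 - 0)"
    by (intro bounded_conv_diff bounded_conv_divide_point bounded_conv_scalar tendsto_const) auto
  show ?thesis
    unfolding eta_par_def[abs_def] eta_inf_def[abs_def]
    using bounded_conv_divide_point[of "\<lambda>u. cis \<phi>0" Im] * bounded_conv_divide_point[of shape Re]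
    by (cases "i = 1"; cases "i = 2") simp_all
qed

lemma bounded_conv_xi: "bounded_conv (\<lambda>d. xi_par d i) (xi_inf i)"
proof -
  have *: "bounded_conv (\<lambda>d u. 1 - Re (shape u / point d u)) (\<lambda>u. 1 - 0)"
    by (intro bounded_conv_diff bounded_conv_divide_point bounded_conv_scalar tendsto_const) auto
  show ?thesis
    unfolding xi_par_def[abs_def] xi_inf_def[abs_def]
    using bounded_conv_divide_point[of "\<lambda>u. cis \<phi>0" Im] * bounded_conv_uminus[OF *]
    by (cases "i = 1"; cases "i = 2") simp_all
qed

lemma bounded_conv_cos: "bounded_conv (\<lambda>d u. Re (sgn (point d u))) (\<lambda>u. cos \<phi>0)"
proof (rule bounded_convI[where X = "{}" and K = 1])
  show "\<forall>\<^sub>F d in at_top. \<forall>u\<in>{0..2*pi}. \<bar>Re (sgn (point d u))\<bar> \<le> 1"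
    using order_trans[OF abs_Re_le_cmod, of "sgn z" 1 for z]
    by (intro always_eventually) (simp add: norm_sgn)
  show "((\<lambda>d. Re (sgn (point d u))) \<longlongrightarrow> cos \<phi>0) at_top" for u
    using tendsto_Re[OF tendsto_sgn_point[of u]] by simp
qed auto

abbreviation star where "star \<equiv> star_prod Q (par 0)"
abbreviation proj where "proj \<equiv> proj_perp Q (par 0)"

lemma tendsto_star:
  assumes "bounded_conv F f" "bounded_conv G g"
  shows "((\<lambda>d. star (F d) (G d)) \<longlongrightarrow> star f g) at_top"
proof -
  obtain K where "\<And>u. u \<in> {0..2*pi} \<Longrightarrow> cmod (tang u) \<le> K"
    using tang_bounded by metis
  then have "bounded_conv (\<lambda>d u. cmod (tang u)) (\<lambda>u. cmod (tang u))"
    by (intro bounded_conv_fun) auto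
  then show ?thesis
    unfolding star_prod_def contour_dot_par
    by (intro tendsto_set_lebesgue_integral bounded_conv_mult assms)
qed

lemma bounded_conv_proj:
  assumes "bounded_conv W w" "bounded_conv F f" "star w w \<noteq> 0"
  shows "bounded_conv (\<lambda>d. proj (W d) (F d)) (proj w f)"
  unfolding proj_perp_def
  by (intro bounded_conv_diff bounded_conv_mult bounded_conv_scalar tendsto_intros tendsto_star assms)

end

subsection \<open>Nondegeneracy of the limit\<close>

definition t_matrix :: "real \<Rightarrow> real \<Rightarrow> real \<Rightarrow> real \<Rightarrow> real^3^3" where
  "t_matrix L A B Z = vector [vector [L, A, - A], vector [A, Z + B, - B], vector [- A, - B, B]]"

text \<open>Adding the third row to the second leaves \<open>[0, Z, 0]\<close>, which reduces the
  determinant to that of a two by two block.\<close>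

lemma det_t_matrix: "det (t_matrix L A B Z) = Z * (L * B - A\<^sup>2)"
  by (simp add: det_3 t_matrix_def power2_eq_square algebra_simps)

lemma t_matrix_inverse:
  fixes L A B Z :: real
  assumes L: "0 < L" and Z: "Z \<noteq> 0" and D: "0 < L * B - A\<^sup>2"
  defines "S \<equiv> vector [vector [inverse (L - A\<^sup>2 / B), 0, - inverse (A - L * B / A)],
              vector [0, inverse Z, inverse Z],
              vector [- inverse (A - L * B / A), inverse Z, inverse Z + inverse (B - A\<^sup>2 / L)]]
              :: real^3^3"
  shows "t_matrix L A B Z ** S = mat 1" "S ** t_matrix L A B Z = mat 1"
proof -
  define D where "D = L * B - A\<^sup>2"
  have D0: "D \<noteq> 0"
    using D by (simp add: D_def)
  have "0 < L * B"
    using D zero_le_power2[of A] by linarith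
  then have B: "0 < B"
    using L by (simp add: zero_less_mult_iff)
  have e1: "inverse (L - A\<^sup>2 / B) = B / D" and e2: "inverse (B - A\<^sup>2 / L) = L / D"
  proof -
    have "L - A\<^sup>2 / B = D / B" "B - A\<^sup>2 / L = D / L"
      using L B by (simp_all add: D_def field_simps)
    then show "inverse (L - A\<^sup>2 / B) = B / D" "inverse (B - A\<^sup>2 / L) = L / D"
      by (simp_all only: inverse_divide)
  qed
  have e3: "- inverse (A - L * B / A) = A / D"
  proof (cases "A = 0")
    case False
    then have "A - L * B / A = - (D / A)"
      by (simp add: D_def field_simps power2_eq_square)
    then show ?thesis
      by simp
  qed simp
  \<comment> \<open>\<open>[[x, y], [y, z]]\<close> is the inverse of
    \<open>[[L, - A], [- A, B]]\<close>; the facts \<open>rel\<close> are the equations of that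
    product. With them the three by three products become linear rewriting.\<close>
  define x y z where "x = B / D" and "y = A / D" and "z = L / D"
  have rel: "L * x - A * y = 1" "B * z - A * y = 1" "L * y = A * z" "A * x = B * y"
  proof -
    have "L * x - A * y = D / D" "B * z - A * y = D / D"
      by (simp_all only: x_def y_def z_def times_divide_eq_right power2_eq_square mult.commute[of B L]
          diff_divide_distrib[symmetric] D_def[symmetric, unfolded power2_eq_square])
    then show "L * x - A * y = 1" "B * z - A * y = 1"
      using D0 by simp_all
    show "L * y = A * z" "A * x = B * y"
      by (simp_all add: x_def y_def z_def)
  qed
  have iZ: "Z * inverse Z = 1"
    using Z by simp
  have S: "S = vector [vector [x, 0, y], vector [0, inverse Z, inverse Z],
      vector [y, inverse Z, inverse Z + z]]"
    unfolding S_def e1 e2 e3 x_def y_def z_def by (rule refl)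
  show "t_matrix L A B Z ** S = mat 1" "S ** t_matrix L A B Z = mat 1"
    unfolding S t_matrix_def using rel iZ
    by (simp_all add: vec_eq_iff forall_3 matrix_matrix_mult_def sum_3 mat_def)
      (auto simp: algebra_simps)
qed

section \<open>Elementary algebra of the star product\<close>

lemma star_prod_self_nonneg: "0 \<le> star_prod Q \<gamma> f f"
  unfolding star_prod_def set_lebesgue_integral_def by (intro Bochner_Integration.integral_nonneg) simp

lemma star_norm_power2 [simp]: "(star_norm Q \<gamma> f)\<^sup>2 = star_prod Q \<gamma> f f"
  by (simp add: star_norm_def star_prod_self_nonneg)

lemma star_prod_scale:
  "star_prod Q \<gamma> (\<lambda>u. c * f u) g = c * star_prod Q \<gamma> f g"
  "star_prod Q \<gamma> f (\<lambda>u. c * g u) = c * star_prod Q \<gamma> f g"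
proof -
  have "(\<lambda>u. c * f u * g u * w u) = (\<lambda>u. c * (f u * g u * w u))"
    "(\<lambda>u. f u * (c * g u) * w u) = (\<lambda>u. c * (f u * g u * w u))" for w :: "real \<Rightarrow> real"
    by (auto simp: mult_ac)
  then show "star_prod Q \<gamma> (\<lambda>u. c * f u) g = c * star_prod Q \<gamma> f g"
    "star_prod Q \<gamma> f (\<lambda>u. c * g u) = c * star_prod Q \<gamma> f g"
    unfolding star_prod_def by simp_all
qed

lemma star_prod_uminus [simp]:
  "star_prod Q \<gamma> (\<lambda>u. - f u) g = - star_prod Q \<gamma> f g"
  "star_prod Q \<gamma> f (\<lambda>u. - g u) = - star_prod Q \<gamma> f g"
  using star_prod_scale[where c = "-1"] by simp_all

lemma star_prod_zero [simp]:
  "star_prod Q \<gamma> (\<lambda>u. 0) g = 0" "star_prod Q \<gamma> f (\<lambda>u. 0) = 0"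
  using star_prod_scale[where c = 0] by simp_all

lemma proj_perp_uminus: "proj_perp Q \<gamma> w (\<lambda>u. - f u) = (\<lambda>u. - proj_perp Q \<gamma> w f u)"
  by (auto simp: proj_perp_def)

lemma proj_perp_zero: "proj_perp Q \<gamma> w (\<lambda>u. 0) = (\<lambda>u. 0)"
  by (auto simp: proj_perp_def)

lemma AE_of_set_integral_eq_zero:
  fixes f :: "real \<Rightarrow> real"
  assumes "set_integrable lebesgue S f" "\<And>u. u \<in> S \<Longrightarrow> 0 \<le> f u"
    and "(LINT u:S|lebesgue. f u) = 0"
  shows "AE u in lebesgue. u \<in> S \<longrightarrow> f u = 0"
proof -
  have "AE u in lebesgue. indicator S u *\<^sub>R f u = 0"
    using assms integral_nonneg_eq_0_iff_AE[of lebesgue "\<lambda>u. indicator S u *\<^sub>R f u"]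
    unfolding set_integrable_def set_lebesgue_integral_def
    by (auto simp: indicator_def)
  then show ?thesis
    by eventually_elim (auto simp: indicator_def)
qed

context extended_target
begin

lemma star_integrable:
  assumes f: "f \<in> borel_measurable borel" "\<And>u. u \<in> {0..2*pi} \<Longrightarrow> \<bar>f u\<bar> \<le> K"
  shows "set_integrable lebesgue {0..2*pi} (\<lambda>u. f u * cmod (tang u))"
proof -
  obtain K' where K': "\<And>u. u \<in> {0..2*pi} \<Longrightarrow> cmod (tang u) \<le> K'"
    using tang_bounded by metis
  show ?thesis
  proof (rule set_integrable_bounded_borel)
    show "(\<lambda>u. f u * cmod (tang u)) \<in> borel_measurable borel"
      using f(1) by measurable
    show "\<bar>f u * cmod (tang u)\<bar> \<le> K * K'" if "u \<in> {0..2*pi}" for u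
      unfolding abs_mult using f(2)[OF that] K'[OF that] by (intro mult_mono) auto
  qed
qed

lemma cross_bounded:
  obtains K where "\<And>u. u \<in> {0..2*pi} \<Longrightarrow> \<bar>cross u\<bar> \<le> K"
proof -
  obtain K where "\<And>u. u \<in> {0..2*pi} \<Longrightarrow> cmod (shape u) \<le> K"
    using shape_bounded by metis
  then have "\<bar>cross u\<bar> \<le> K" if "u \<in> {0..2*pi}" for u
    using that abs_Im_le_cmod[of "shape u / cis \<phi>0"] by (force simp: cross_def norm_divide)
  then show thesis
    by (rule that)
qed

lemma finite_cross_level: "finite {u \<in> {0..2*pi}. cross u = \<kappa>}"
proof -
  have "cross u = Re (- \<i> * cnj (cis \<phi>0) * shape u)" for u
    unfolding cross_def by (subst complex_div_cnj) simp
  then show ?thesis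
    using finite_shape_level[of "- \<i> * cnj (cis \<phi>0)" \<kappa>] by (simp only: mult_eq_0_iff) simp
qed

text \<open>
  Equality in the Cauchy-Schwarz inequality would force \<open>cross\<close> to be constant on the support
  of \<open>f\<close>, but a nonconstant trigonometric polynomial takes each value only finitely often.
\<close>

lemma star_Cauchy_Schwarz_strict:
  assumes f: "f \<in> borel_measurable borel" "\<And>u. \<bar>f u\<bar> \<le> 1" and nz: "star f f \<noteq> 0"
  shows "(star f (\<lambda>u. f u * cross u))\<^sup>2 < star f f * star (\<lambda>u. f u * cross u) (\<lambda>u. f u * cross u)"
proof -
  \<comment> \<open>The weighted mean of \<open>cross\<close>, which minimizes the weighted integral
    of \<open>(cross u - \<kappa>)\<^sup>2\<close>; the minimum is the Cauchy-Schwarz deficit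
    divided by \<open>star f f\<close>.\<close>
  define \<kappa> where "\<kappa> = star f (\<lambda>u. f u * cross u) / star f f"
  obtain K where K: "\<And>u. u \<in> {0..2*pi} \<Longrightarrow> \<bar>cross u\<bar> \<le> K"
    using cross_bounded by metis
  note f(1) [measurable]
  have f2: "\<bar>(f u)\<^sup>2\<bar> \<le> 1" for u
    using f(2)[of u] by (simp add: abs_square_le_1)
  have int: "set_integrable lebesgue {0..2*pi} (\<lambda>u. (f u)\<^sup>2 * p (cross u) * cmod (tang u))"
    if p: "continuous_on UNIV p" for p :: "real \<Rightarrow> real"
  proof -
    have [measurable]: "p \<in> borel_measurable borel"
      using p by (rule borel_measurable_continuous_onI)
    have "bounded (p ` {-K..K})"
      using p by (intro compact_imp_bounded compact_continuous_image continuous_on_subset[OF p]) auto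
    then obtain C where "\<forall>x\<in>{-K..K}. \<bar>p x\<bar> \<le> C"
      by (auto simp: bounded_iff)
    then have C: "\<And>x. x \<in> {-K..K} \<Longrightarrow> \<bar>p x\<bar> \<le> C"
      by blast
    show ?thesis
    proof (rule star_integrable)
      show "\<bar>(f u)\<^sup>2 * p (cross u)\<bar> \<le> 1 * C" if "u \<in> {0..2*pi}" for u
        unfolding abs_mult[of "(f u)\<^sup>2"] using f2 C[of "cross u"] K[OF that]
        by (intro mult_mono) (auto simp: abs_le_iff)
    qed measurable
  qed
  have i2: "set_integrable lebesgue {0..2*pi} (\<lambda>u. (f u)\<^sup>2 * (cross u)\<^sup>2 * cmod (tang u))"
    and i1: "set_integrable lebesgue {0..2*pi} (\<lambda>u. (f u)\<^sup>2 * cross u * cmod (tang u))"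
    and i0: "set_integrable lebesgue {0..2*pi} (\<lambda>u. (f u)\<^sup>2 * 1 * cmod (tang u))"
    by (intro int continuous_intros)+
  note j1 = set_integrable_mult_right[OF i1, of "2 * \<kappa>"]
    and j0 = set_integrable_mult_right[OF i0, of "\<kappa>\<^sup>2"]
  let ?I = "\<lambda>p. LINT u:{0..2*pi}|lebesgue. (f u)\<^sup>2 * p (cross u) * cmod (tang u)"
  have "star f f = ?I (\<lambda>x. 1)" "star f (\<lambda>u. f u * cross u) = ?I (\<lambda>x. x)"
    "star (\<lambda>u. f u * cross u) (\<lambda>u. f u * cross u) = ?I (\<lambda>x. x\<^sup>2)"
    by (simp_all add: star_prod_def contour_dot_par power2_eq_square mult_ac)
  note star_eq = this
  have "?I (\<lambda>x. (x - \<kappa>)\<^sup>2) = (LINT u:{0..2*pi}|lebesgue.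
      (f u)\<^sup>2 * (cross u)\<^sup>2 * cmod (tang u) - 2 * \<kappa> * ((f u)\<^sup>2 * cross u * cmod (tang u))
      + \<kappa>\<^sup>2 * ((f u)\<^sup>2 * 1 * cmod (tang u)))"
    by (intro arg_cong[where f = "set_lebesgue_integral lebesgue {0..2*pi}"] ext)
      (simp add: power2_eq_square algebra_simps)
  also have "\<dots> = ?I (\<lambda>x. x\<^sup>2) - 2 * \<kappa> * ?I (\<lambda>x. x) + \<kappa>\<^sup>2 * ?I (\<lambda>x. 1)"
    using set_integral_add(2)[OF set_integral_diff(1)[OF i2 j1] j0] set_integral_diff(2)[OF i2 j1]
    by simp
  also have "\<dots> = star (\<lambda>u. f u * cross u) (\<lambda>u. f u * cross u)
      - 2 * \<kappa> * star f (\<lambda>u. f u * cross u) + \<kappa>\<^sup>2 * star f f"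
    by (simp only: star_eq)
  also have "\<dots> = star (\<lambda>u. f u * cross u) (\<lambda>u. f u * cross u)
      - (star f (\<lambda>u. f u * cross u))\<^sup>2 / star f f"
    using nz by (simp add: \<kappa>_def power2_eq_square field_simps)
  finally have deficit: "?I (\<lambda>x. (x - \<kappa>)\<^sup>2) = star (\<lambda>u. f u * cross u) (\<lambda>u. f u * cross u)
      - (star f (\<lambda>u. f u * cross u))\<^sup>2 / star f f" .
  have pos: "0 < star f f"
    using nz star_prod_self_nonneg[of Q "par 0" f] by linarith
  have nonneg: "0 \<le> ?I (\<lambda>x. (x - \<kappa>)\<^sup>2)"
    unfolding set_lebesgue_integral_def by (intro Bochner_Integration.integral_nonneg) simp
  have "?I (\<lambda>x. (x - \<kappa>)\<^sup>2) \<noteq> 0"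
  proof
    assume "?I (\<lambda>x. (x - \<kappa>)\<^sup>2) = 0"
    then have "AE u in lebesgue. u \<in> {0..2*pi} \<longrightarrow> (f u)\<^sup>2 * (cross u - \<kappa>)\<^sup>2 * cmod (tang u) = 0"
      by (intro AE_of_set_integral_eq_zero int continuous_intros) auto
    moreover have "AE u in lebesgue. u \<notin> {u \<in> {0..2*pi}. cross u = \<kappa>}"
      using finite_cross_level
      by (intro AE_not_in) (simp add: negligible_finite flip: negligible_iff_null_sets)
    ultimately have "AE u in lebesgue. indicator {0..2*pi} u *\<^sub>R (f u * f u * cmod (tang u)) = 0"
      by eventually_elim (auto simp: indicator_def)
    then have "star f f = 0"
      unfolding star_prod_def set_lebesgue_integral_def contour_dot_par
      by (rule integral_eq_zero_AE)
    then show False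
      using nz by simp
  qed
  then have "0 < ?I (\<lambda>x. (x - \<kappa>)\<^sup>2)"
    using nonneg by linarith
  then show ?thesis
    unfolding deficit using pos by (simp add: divide_less_eq mult.commute)
qed

text \<open>
  Up to a positive factor, \<open>Im (view_inf u)\<close> is minus the derivative of \<open>cross\<close>, which is periodic
  and nonconstant.
\<close>

lemma some_arc_visible: "\<exists>u. 0 < u \<and> u < 2 * pi \<and> 0 < Im (view_inf u)"
proof (rule ccontr)
  assume neg: "\<not> ?thesis"
  define g where "g u = - Im (shape u / cis \<phi>0)" for u
  have deriv: "(g has_real_derivative - Im (tang u / cis \<phi>0)) (at u)" for u
    unfolding g_def has_real_derivative_iff_has_vector_derivative
    by (intro has_vector_derivative_minus bounded_linear.has_vector_derivative[OF bounded_linear_Im]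
        has_vector_derivative_divide has_vector_derivative_shape)
  have nonpos: "- Im (tang u / cis \<phi>0) \<le> 0" if "0 < u" "u < 2 * pi" for u
  proof -
    have "Im (view_inf u) \<le> 0"
      using neg that by force
    then have "Im (cis \<phi>0 * cnj (tang u)) \<le> 0"
      unfolding Im_view_inf[symmetric] by (simp add: mult_nonneg_nonpos)
    then show ?thesis
      by (subst complex_div_cnj) (simp add: algebra_simps)
  qed
  have mono: "g y \<le> g x" if "0 \<le> x" "x \<le> y" "y \<le> 2 * pi" for x y
  proof (rule DERIV_nonpos_imp_decreasing_open[OF that(2)])
    show "\<exists>D. (g has_real_derivative D) (at u) \<and> D \<le> 0" if "x < u" "u < y" for u
      using deriv nonpos[of u] that \<open>0 \<le> x\<close> \<open>y \<le> 2 * pi\<close> by force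
    show "continuous_on {x..y} g"
      unfolding g_def by (intro continuous_intros continuous_on_shape) simp
  qed
  have "shape (2 * pi) = shape 0"
  proof -
    have "cos (real k * (2 * pi)) = 1" "sin (real k * (2 * pi)) = 0" for k
      using cos_int_2pin[of "int k"] sin_int_2pin[of "int k"] by (simp_all add: mult_ac)
    then show ?thesis
      by (simp add: shape_def rho_par)
  qed
  then have "g (2 * pi) = g 0"
    by (simp add: g_def)
  \<comment> \<open>Without a visible arc \<open>g\<close> is nonincreasing, and equal values at
    both ends of the period force it to be constant.\<close>
  have level: "cross u = - g 0" if "u \<in> {0..2*pi}" for u
  proof -
    have "g u = g 0"
      using mono[of 0 u] mono[of u "2 * pi"] that \<open>g (2 * pi) = g 0\<close> by simp
    then show ?thesis
      by (simp add: cross_def g_def)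
  qed
  have "{0..2*pi} \<subseteq> {u \<in> {0..2*pi}. cross u = - g 0}"
    using level by blast
  then have "finite {0..2*pi}"
    using finite_cross_level finite_subset by blast
  then show False
    by (simp add: infinite_Icc)
qed

text \<open>A vanishing star norm would make the visible arguments a null set, but they contain a
  nonempty open set.\<close>

lemma star_w_inf: "0 < star w_inf w_inf"
  unfolding w_inf_def[abs_def]
proof (rule ccontr)
  let ?w = "\<lambda>u. lambert_w \<alpha> (view_inf u)"
  \<comment> \<open>Visibility is stated through the tangent because that expression is continuous
    in \<open>u\<close>, which makes the set open; \<open>view_inf\<close> may jump where the
    tangent vanishes.\<close>
  let ?V = "{u. 0 < Im (cis \<phi>0 * cnj (tang u))} \<inter> {0<..<2*pi}"
  assume "\<not> 0 < star ?w ?w"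
  then have "star ?w ?w = 0"
    using star_prod_self_nonneg[of Q "par 0" ?w] by simp
  then have "(LINT u:{0..2*pi}|lebesgue. ?w u * ?w u * cmod (tang u)) = 0"
    by (simp add: star_prod_def contour_dot_par)
  moreover have "set_integrable lebesgue {0..2*pi} (\<lambda>u. ?w u * ?w u * cmod (tang u))"
  proof (rule star_integrable)
    show "\<bar>?w u * ?w u\<bar> \<le> 1 * 1" for u
      unfolding abs_mult using lambert_w_bound[OF roughness norm_view_le(2)] by (intro mult_mono) auto
    show "(\<lambda>u. ?w u * ?w u) \<in> borel_measurable borel"
      by measurable
  qed
  ultimately have "AE u in lebesgue. u \<in> {0..2*pi} \<longrightarrow> ?w u * ?w u * cmod (tang u) = 0"
    by (intro AE_of_set_integral_eq_zero) auto
  then have AE: "AE u in lebesgue. u \<notin> ?V"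
  proof eventually_elim
    case (elim u)
    show ?case
    proof
      assume u: "u \<in> ?V"
      then have "0 < cmod (tang u) * Im (view_inf u)"
        by (simp only: Im_view_inf) simp
      then have "0 < cmod (tang u)" "0 < Im (view_inf u)"
        by (auto simp: zero_less_mult_iff)
      then show False
        using elim u by (simp add: lambert_w_def)
    qed
  qed
  have V: "open ?V"
    by (intro open_Int open_Collect_less continuous_intros continuous_on_tang)
  then have "?V \<in> sets lebesgue"
    by (intro sets_completionI_sets) (simp add: borel_open)
  then have "negligible ?V"
    using AE AE_iff_null_sets[of ?V lebesgue] by (simp add: negligible_iff_null_sets)
  moreover have "?V \<noteq> {}"
  proof -
    obtain u where u: "0 < u" "u < 2 * pi" "0 < Im (view_inf u)"
      using some_arc_visible by blast
    then have "tang u \<noteq> 0"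
      by (auto simp: view_inf_def)
    then have "0 < cmod (tang u) * Im (view_inf u)"
      using u(3) by simp
    then have "0 < Im (cis \<phi>0 * cnj (tang u))"
      by (simp only: Im_view_inf)
    then have "u \<in> ?V"
      using u(1,2) by (intro IntI CollectI; simp)
    then show ?thesis
      by blast
  qed
  ultimately show False
    using open_not_negligible[OF V] by blast
qed

subsection \<open>Assembling the bound\<close>


lemma w_par_measurable: "w_par d \<in> borel_measurable borel"
  unfolding w_par_def[abs_def] by measurable

lemma w_inf_measurable: "w_inf \<in> borel_measurable borel"
  unfolding w_inf_def[abs_def] by measurable

lemma w_par_bound: "\<bar>w_par d u\<bar> \<le> 1"
  unfolding w_par_def by (intro lambert_w_bound roughness norm_view_le)

lemma w_inf_bound: "\<bar>w_inf u\<bar> \<le> 1"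
  unfolding w_inf_def by (intro lambert_w_bound roughness norm_view_le)

lemma star_w_fun: "star (w_fun \<alpha> Q (par d)) (w_fun \<alpha> Q (par d)) = star (w_par d) (w_par d)"
  by (intro star_prod_cong w_fun_par)

text \<open>\<open>A\<close> as a functional of the weight, with the normalization of
  \<open>w_bar\<close> pulled out, so that one formula serves both at distance \<open>d\<close> and
  in the limit. \<open>angle_coef\<close> does the same for \<open>B\<close>.\<close>

definition range_coef :: "real \<Rightarrow> (real \<Rightarrow> real) \<Rightarrow> real" where
  "range_coef L w = L * star w (\<lambda>u. w u * cross u) / star w w"

definition angle_coef :: "real \<Rightarrow> (real \<Rightarrow> real) \<Rightarrow> (real \<Rightarrow> real) \<Rightarrow> real" where
  "angle_coef L w v = (L * star (\<lambda>u. w u * cross u) (\<lambda>u. w u * cross u)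
     + (\<alpha> + 1)\<^sup>2 * star (proj w v) (proj w v)) / star w w"

text \<open>Multiplied by \<open>S0\<^sup>2\<close>, the expression is \<open>L\<^sup>2\<close>
  times the Cauchy-Schwarz deficit plus \<open>L * P * S0\<close>. The projection term
  \<open>P\<close> is only known to be nonnegative, so strictness comes from the deficit.\<close>

lemma coef_discriminant_pos:
  assumes w: "w \<in> borel_measurable borel" "\<And>u. \<bar>w u\<bar> \<le> 1" "star w w \<noteq> 0" and L: "0 < L"
  shows "0 < L * angle_coef L w v - (range_coef L w)\<^sup>2"
proof -
  define S0 S1 S2 P where "S0 = star w w" and "S1 = star w (\<lambda>u. w u * cross u)"
    and "S2 = star (\<lambda>u. w u * cross u) (\<lambda>u. w u * cross u)"
    and "P = (\<alpha> + 1)\<^sup>2 * star (proj w v) (proj w v)"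
  have S0: "0 < S0"
    using w(3) star_prod_self_nonneg[of Q "par 0" w] by (simp add: S0_def)
  have P: "0 \<le> P"
    by (simp add: P_def star_prod_self_nonneg)
  have "S1\<^sup>2 < S0 * S2"
    unfolding S0_def S1_def S2_def by (intro star_Cauchy_Schwarz_strict w)
  then have "0 < L\<^sup>2 * (S0 * S2 - S1\<^sup>2) + L * P * S0"
    using L P S0 by (intro add_pos_nonneg mult_pos_pos mult_nonneg_nonneg) auto
  then have "0 < (L\<^sup>2 * (S0 * S2 - S1\<^sup>2) + L * P * S0) / S0\<^sup>2"
    using S0 by simp
  also have "\<dots> = L * ((L * S2 + P) / S0) - (L * S1 / S0)\<^sup>2"
    using S0 by (simp add: field_simps power2_eq_square)
  finally show ?thesis
    by (simp add: range_coef_def angle_coef_def S0_def S1_def S2_def P_def)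
qed

lemma cross_range_par:
  assumes "0 < d"
  shows "cross_range Q (par d) u = cross u"
proof -
  have perp: "perp (centre (par d)) = of_real d * (\<i> * cis \<phi>0)"
    by (simp add: perp_def centre_eq complex_eq_iff)
  have "norm (of_real d * (\<i> * cis \<phi>0)) = d"
    using assms by (simp add: norm_mult)
  then have "perp (centre (par d)) /\<^sub>R norm (perp (centre (par d))) = \<i> * cis \<phi>0"
    unfolding perp using assms by (simp add: scaleR_conv_of_real)
  moreover have "rotate_by (par d 3) (rho Q (par d) u) = shape u"
    by (simp add: rotate_by_eq shape_def rho_par)
  moreover have "cross u = inner (\<i> * cis \<phi>0) (shape u)"
    unfolding cross_def by (subst complex_div_cnj) (simp add: inner_complex_def)
  ultimately show ?thesis
    by (simp only: cross_range_def)
qed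

lemma w_bar_par: "w_bar \<alpha> Q (par d) = (\<lambda>u. inverse (sqrt (star (w_par d) (w_par d))) * w_fun \<alpha> Q (par d) u)"
  by (auto simp: w_bar_def star_norm_def star_prod_par[of d] star_w_fun divide_inverse)

lemma w_fun_cross:
  assumes "0 < d"
  shows "eq_off_finite (\<lambda>u. w_fun \<alpha> Q (par d) u * cross_range Q (par d) u) (\<lambda>u. w_par d u * cross u)"
  unfolding cross_range_par[OF assms] by (intro eq_off_finite_comp2[where h = "(*)"] w_fun_par eq_off_finite_refl)

lemma coef_A_par:
  assumes "0 < d"
  shows "coef_A L \<alpha> Q (par d) = range_coef L (w_par d)"
proof -
  let ?s = "star (w_par d) (w_par d)"
  have "coef_A L \<alpha> Q (par d)
      = L * star (\<lambda>u. inverse (sqrt ?s) * w_fun \<alpha> Q (par d) u)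
                 (\<lambda>u. inverse (sqrt ?s) * (w_fun \<alpha> Q (par d) u * cross_range Q (par d) u))"
    by (simp only: coef_A_def star_prod_par[of d] w_bar_par mult.assoc)
  also have "\<dots> = L * (inverse (sqrt ?s) * inverse (sqrt ?s)
      * star (w_fun \<alpha> Q (par d)) (\<lambda>u. w_fun \<alpha> Q (par d) u * cross_range Q (par d) u))"
    by (simp only: star_prod_scale mult.assoc)
  also have "inverse (sqrt ?s) * inverse (sqrt ?s) = inverse ?s"
    by (simp add: star_prod_self_nonneg flip: inverse_mult_distrib)
  also have "star (w_fun \<alpha> Q (par d)) (\<lambda>u. w_fun \<alpha> Q (par d) u * cross_range Q (par d) u)
      = star (w_par d) (\<lambda>u. w_par d u * cross u)"
    by (intro star_prod_cong w_fun_par w_fun_cross assms)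
  finally show ?thesis
    by (simp add: range_coef_def divide_inverse mult_ac)
qed

lemma coef_B_par:
  assumes "0 < d"
  shows "coef_B L \<alpha> Q (par d) = angle_coef L (w_par d) (v_par d)"
proof -
  let ?s = "star (w_par d) (w_par d)"
  have "star (\<lambda>u. w_bar \<alpha> Q (par d) u * cross_range Q (par d) u)
             (\<lambda>u. w_bar \<alpha> Q (par d) u * cross_range Q (par d) u)
      = star (\<lambda>u. inverse (sqrt ?s) * (w_fun \<alpha> Q (par d) u * cross_range Q (par d) u))
             (\<lambda>u. inverse (sqrt ?s) * (w_fun \<alpha> Q (par d) u * cross_range Q (par d) u))"
    by (simp only: w_bar_par mult.assoc)
  also have "\<dots> = inverse (sqrt ?s) * inverse (sqrt ?s)
      * star (\<lambda>u. w_fun \<alpha> Q (par d) u * cross_range Q (par d) u)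
             (\<lambda>u. w_fun \<alpha> Q (par d) u * cross_range Q (par d) u)"
    by (simp only: star_prod_scale mult.assoc)
  also have "inverse (sqrt ?s) * inverse (sqrt ?s) = inverse ?s"
    by (simp add: star_prod_self_nonneg flip: inverse_mult_distrib)
  also have "star (\<lambda>u. w_fun \<alpha> Q (par d) u * cross_range Q (par d) u)
             (\<lambda>u. w_fun \<alpha> Q (par d) u * cross_range Q (par d) u)
      = star (\<lambda>u. w_par d u * cross u) (\<lambda>u. w_par d u * cross u)"
    by (intro star_prod_cong w_fun_cross assms)
  finally have 1: "star (\<lambda>u. w_bar \<alpha> Q (par d) u * cross_range Q (par d) u)
             (\<lambda>u. w_bar \<alpha> Q (par d) u * cross_range Q (par d) u)
      = inverse ?s * star (\<lambda>u. w_par d u * cross u) (\<lambda>u. w_par d u * cross u)" .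
  have 2: "star (proj (w_fun \<alpha> Q (par d)) (v_fun \<alpha> Q (par d))) (proj (w_fun \<alpha> Q (par d)) (v_fun \<alpha> Q (par d)))
      = star (proj (w_par d) (v_par d)) (proj (w_par d) (v_par d))"
    by (intro star_prod_cong proj_perp_cong w_fun_par v_fun_par)
  show ?thesis
    unfolding coef_B_def star_norm_power2 star_prod_par[of d] proj_perp_par[of d] 1 2 star_w_fun
    by (simp add: angle_coef_def divide_inverse algebra_simps)
qed

text \<open>The bracket of the Fisher information over the squared norm of \<open>w\<close>, without
  the factor \<open>2 * E / N0\<close>. All ingredients are arguments (\<open>c\<close> is the
  cosine of the polar angle), so that the limit matrix is an instance too.\<close>

definition info ::
  "real \<Rightarrow> real \<Rightarrow> (real \<Rightarrow> real) \<Rightarrow> (real \<Rightarrow> real) \<Rightarrow> (real \<Rightarrow> real) \<Rightarrow> (nat \<Rightarrow> real \<Rightarrow> real)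
    \<Rightarrow> (nat \<Rightarrow> real \<Rightarrow> real) \<Rightarrow> (nat \<Rightarrow> real \<Rightarrow> real) \<Rightarrow> nat \<Rightarrow> nat \<Rightarrow> real" where
  "info L M w v c m e x i j =
     (L * star (\<lambda>u. w u * m i u) (\<lambda>u. w u * m j u)
      + M * star (\<lambda>u. w u * c u * e i u) (\<lambda>u. w u * c u * e j u)
      + (\<alpha> + 1)\<^sup>2 * star (proj w (\<lambda>u. v u * x i u)) (proj w (\<lambda>u. v u * x j u))) / star w w"

definition info_par :: "real \<Rightarrow> real \<Rightarrow> real \<Rightarrow> nat \<Rightarrow> nat \<Rightarrow> real" where
  "info_par L M d = info L M (w_par d) (v_par d) (\<lambda>u. Re (sgn (point d u))) (mu_par d) (eta_par d) (xi_par d)"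

lemma EFIM_par:
  assumes i: "i \<in> {1,2,3}" and j: "j \<in> {1,2,3}"
  shows "EFIM L M E N0 \<alpha> Q (par d) i j = 2 * E / N0 * info_par L M d i j"
proof -
  let ?w = "w_fun \<alpha> Q (par d)" and ?v = "v_fun \<alpha> Q (par d)"
  have m: "eq_off_finite (\<lambda>u. ?w u * mu Q (par d) i u) (\<lambda>u. w_par d u * mu_par d i u)"
    if "i \<in> {1,2,3}" for i
    by (intro eq_off_finite_comp2[where h = "(*)"] w_fun_par mu_par_eq that)
  have e: "eq_off_finite (\<lambda>u. ?w u * cos (phi Q (par d) u) * eta Q (par d) i u)
      (\<lambda>u. w_par d u * Re (sgn (point d u)) * eta_par d i u)" if "i \<in> {1,2,3}" for i
    by (intro eq_off_finite_comp2[where h = "(*)"] w_fun_par cos_phi_eq eta_par_eq that)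
  have x: "eq_off_finite (proj ?w (\<lambda>u. ?v u * xi Q (par d) i u))
      (proj (w_par d) (\<lambda>u. v_par d u * xi_par d i u))" if "i \<in> {1,2,3}" for i
    by (intro proj_perp_cong eq_off_finite_comp2[where h = "(*)"] w_fun_par v_fun_par xi_par_eq that)
  show ?thesis
    unfolding EFIM_def Let_def star_norm_power2 star_prod_par[of d] proj_perp_par[of d] star_w_fun
      star_prod_cong[OF m[OF i] m[OF j]] star_prod_cong[OF e[OF i] e[OF j]]
      star_prod_cong[OF x[OF i] x[OF j]] info_par_def info_def
    by (simp add: divide_inverse mult_ac)
qed

lemma tendsto_info_par:
  "((\<lambda>d. info_par L M d i j) \<longlongrightarrow> info L M w_inf v_inf (\<lambda>u. cos \<phi>0) mu_inf eta_inf xi_inf i j) at_top"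
  unfolding info_par_def info_def using star_w_inf
  by (intro tendsto_intros tendsto_star bounded_conv_mult bounded_conv_proj bounded_conv_w_par
      bounded_conv_v_par bounded_conv_cos bounded_conv_mu bounded_conv_eta bounded_conv_xi) auto

lemma tendsto_range_coef: "((\<lambda>d. range_coef L (w_par d)) \<longlongrightarrow> range_coef L w_inf) at_top"
proof -
  obtain K where "\<And>u. u \<in> {0..2*pi} \<Longrightarrow> \<bar>cross u\<bar> \<le> K"
    using cross_bounded by metis
  then have "bounded_conv (\<lambda>d. cross) cross"
    by (intro bounded_conv_fun) auto
  then show ?thesis
    unfolding range_coef_def using star_w_inf
    by (intro tendsto_intros tendsto_star bounded_conv_mult bounded_conv_w_par) auto
qed

lemma tendsto_angle_coef:
  "((\<lambda>d. angle_coef L (w_par d) (v_par d)) \<longlongrightarrow> angle_coef L w_inf v_inf) at_top"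
proof -
  obtain K where "\<And>u. u \<in> {0..2*pi} \<Longrightarrow> \<bar>cross u\<bar> \<le> K"
    using cross_bounded by metis
  then have "bounded_conv (\<lambda>d. cross) cross"
    by (intro bounded_conv_fun) auto
  then show ?thesis
    unfolding angle_coef_def using star_w_inf
    by (intro tendsto_intros tendsto_star bounded_conv_mult bounded_conv_proj bounded_conv_w_par
        bounded_conv_v_par) auto
qed

section \<open>Matrix form of the limit and the order of the error\<close>

definition info_matrix :: "(nat \<Rightarrow> nat \<Rightarrow> real) \<Rightarrow> real^3^3" where
  "info_matrix J = vector [vector [J 1 1, J 1 2, J 1 3], vector [J 2 1, J 2 2, J 2 3],
     vector [J 3 1, J 3 2, J 3 3]]"

text \<open>The bearing term survives only in entry (2,2), as \<open>eta_inf\<close> is zero for the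
  other indices; the range and aspect terms change sign between indices 2 and 3. Hence
  \<open>Z\<close> joins \<open>B\<close> in a single entry.\<close>

lemma info_matrix_inf:
  "info_matrix (info L M w_inf v_inf (\<lambda>u. cos \<phi>0) mu_inf eta_inf xi_inf)
    = t_matrix L (range_coef L w_inf) (angle_coef L w_inf v_inf) (M * (cos \<phi>0)\<^sup>2)"
proof -
  have comm: "star (\<lambda>u. w_inf u * cross u) w_inf = star w_inf (\<lambda>u. w_inf u * cross u)"
    by (simp add: star_prod_def mult_ac)
  have scale: "star (\<lambda>u. w_inf u * cos \<phi>0) (\<lambda>u. w_inf u * cos \<phi>0) = (cos \<phi>0)\<^sup>2 * star w_inf w_inf"
    using star_prod_scale(1)[of Q "par 0" "cos \<phi>0" w_inf] star_prod_scale(2)[of Q "par 0" _ "cos \<phi>0" w_inf]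
    by (simp add: mult.commute power2_eq_square)
  have nz: "star w_inf w_inf \<noteq> 0"
    using star_w_inf by simp
  show ?thesis
    using nz unfolding info_matrix_def t_matrix_def
    by (simp add: info_def mu_inf_def eta_inf_def xi_inf_def range_coef_def angle_coef_def
        proj_perp_uminus proj_perp_zero comm scale add_divide_distrib diff_divide_distrib add_ac)
qed

lemma EFIM11_par:
  "EFIM11 L M E N0 \<alpha> Q (par d) = (2 * E / N0) *\<^sub>R info_matrix (info_par L M d)"
  by (simp add: EFIM11_def Let_def info_matrix_def EFIM_par vec_eq_iff forall_3)

lemma T11_par:
  assumes "0 < d"
  shows "T11 L M \<alpha> Q (par d)
    = t_matrix L (range_coef L (w_par d)) (angle_coef L (w_par d) (v_par d)) (M * (cos \<phi>0)\<^sup>2)"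
  by (simp add: T11_def Let_def t_matrix_def coef_A_par coef_B_par coef_Z_def assms)

lemma T11_inverse:
  assumes d: "0 < d" and L: "0 < L" and Z: "M * (cos \<phi>0)\<^sup>2 \<noteq> 0" and nz: "star (w_par d) (w_par d) \<noteq> 0"
  shows "T11 L M \<alpha> Q (par d) ** T11_inv L M \<alpha> Q (par d) = mat 1"
    and "T11_inv L M \<alpha> Q (par d) ** T11 L M \<alpha> Q (par d) = mat 1"
  unfolding T11_par[OF d] T11_inv_def Let_def coef_A_par[OF d] coef_B_par[OF d] coef_Z_def par_simps
  by (intro t_matrix_inverse L Z coef_discriminant_pos w_par_measurable w_par_bound nz)+

lemma tendsto_T11:
  "((\<lambda>d. T11 L M \<alpha> Q (par d) $ i $ j) \<longlongrightarrow>
    t_matrix L (range_coef L w_inf) (angle_coef L w_inf v_inf) (M * (cos \<phi>0)\<^sup>2) $ i $ j) at_top"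
proof -
  have "((\<lambda>d. t_matrix L (range_coef L (w_par d)) (angle_coef L (w_par d) (v_par d)) (M * (cos \<phi>0)\<^sup>2) $ i $ j)
      \<longlongrightarrow> t_matrix L (range_coef L w_inf) (angle_coef L w_inf v_inf) (M * (cos \<phi>0)\<^sup>2) $ i $ j) at_top"
    using exhaust_3[of i] exhaust_3[of j] unfolding t_matrix_def
    by (elim disjE; simp add: tendsto_add tendsto_minus tendsto_range_coef tendsto_angle_coef)
  moreover have "\<forall>\<^sub>F d in at_top. t_matrix L (range_coef L (w_par d)) (angle_coef L (w_par d) (v_par d))
      (M * (cos \<phi>0)\<^sup>2) $ i $ j = T11 L M \<alpha> Q (par d) $ i $ j"
    using eventually_gt_at_top[of 0] by eventually_elim (simp add: T11_par)
  ultimately show ?thesis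
    by (rule Lim_transform_eventually)
qed

lemma tendsto_info_matrix:
  "((\<lambda>d. info_matrix (info_par L M d) $ i $ j) \<longlongrightarrow>
    t_matrix L (range_coef L w_inf) (angle_coef L w_inf v_inf) (M * (cos \<phi>0)\<^sup>2) $ i $ j) at_top"
  unfolding info_matrix_inf[symmetric]
  using exhaust_3[of i] exhaust_3[of j] unfolding info_matrix_def
  by (elim disjE; simp add: tendsto_info_par[unfolded One_nat_def])

lemma CRB_asymptotics:
  fixes G L M N0 :: real and N :: nat
  assumes L: "0 < L" and M: "0 < M" and \<phi>0: "cos \<phi>0 \<noteq> 0" and G: "0 < G" and N0: "0 < N0" and N: "0 < N"
  defines "E \<equiv> \<lambda>d. received_energy G N \<alpha> Q (par d)"
  shows "\<forall>\<^sub>F d in at_top. invertible (EFIM11 L M (E d) N0 \<alpha> Q (par d))"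
    and "(\<lambda>d. CRB_known_contour L M (E d) N0 \<alpha> Q (par d) $ i $ j
            - inverse (2 * (E d / N0)) * T11_inv L M \<alpha> Q (par d) $ i $ j) \<in> o[at_top](\<lambda>d. d ^ 4)"
proof -
  let ?T = "t_matrix L (range_coef L w_inf) (angle_coef L w_inf v_inf) (M * (cos \<phi>0)\<^sup>2)"
  let ?I = "\<lambda>d. info_matrix (info_par L M d)"
  let ?s = "\<lambda>d. star (w_par d) (w_par d)"
  have Z: "M * (cos \<phi>0)\<^sup>2 \<noteq> 0"
    using M \<phi>0 by simp
  have "0 < L * angle_coef L w_inf v_inf - (range_coef L w_inf)\<^sup>2"
    using star_w_inf by (intro coef_discriminant_pos w_inf_measurable w_inf_bound L) simp
  then have T: "det ?T \<noteq> 0"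
    using Z by (simp add: det_t_matrix)
  have s: "(?s \<longlongrightarrow> star w_inf w_inf) at_top"
    by (intro tendsto_star bounded_conv_w_par)
  have s_ev: "\<forall>\<^sub>F d in at_top. 0 < ?s d"
    using order_tendstoD(1)[OF s star_w_inf] .
  have I_ev: "\<forall>\<^sub>F d in at_top. invertible (?I d)"
    using tendsto_imp_eventually_ne[OF tendsto_det[OF tendsto_info_matrix] T]
    by eventually_elim (simp add: invertible_det_nz)
  \<comment> \<open>The channel gain contributes \<open>d ^ -4\<close>; the rest of the energy has a
    positive limit, so \<open>inverse (2 * E / N0)\<close> is of exact order
    \<open>d ^ 4\<close>.\<close>
  have E_eq: "E d = G * N * ?s d / d ^ 4" if "0 < d" for d
  proof -
    have "(sqrt G / d\<^sup>2)\<^sup>2 = G / d ^ 4"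
      using G by (simp add: power_divide flip: power_mult)
    then show ?thesis
      by (simp add: E_def received_energy_def star_prod_par[of d] star_w_fun)
  qed
  have E_ev: "\<forall>\<^sub>F d in at_top. 0 < E d"
    using s_ev eventually_gt_at_top[of 0] by eventually_elim (use G N in \<open>simp add: E_eq\<close>)
  show "\<forall>\<^sub>F d in at_top. invertible (EFIM11 L M (E d) N0 \<alpha> Q (par d))"
    using I_ev E_ev
  proof eventually_elim
    case (elim d)
    then show ?case
      unfolding EFIM11_par using N0 by (intro scalar_invertible) auto
  qed
  \<comment> \<open>After division by \<open>d ^ 4\<close> the prefactor has a finite limit, and it
    multiplies a difference of two inverses with the same limit.\<close>
  have "((\<lambda>d. N0 / (2 * G * N * ?s d) * (matrix_inv (?I d) $ i $ j - matrix_inv (T11 L M \<alpha> Q (par d)) $ i $ j))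
      \<longlongrightarrow> N0 / (2 * G * N * star w_inf w_inf) * (matrix_inv ?T $ i $ j - matrix_inv ?T $ i $ j)) at_top"
    using star_w_inf G N by (intro tendsto_intros s tendsto_matrix_inv tendsto_info_matrix tendsto_T11 T) auto
  moreover have "\<forall>\<^sub>F d in at_top.
      N0 / (2 * G * N * ?s d) * (matrix_inv (?I d) $ i $ j - matrix_inv (T11 L M \<alpha> Q (par d)) $ i $ j)
      = (CRB_known_contour L M (E d) N0 \<alpha> Q (par d) $ i $ j
          - inverse (2 * (E d / N0)) * T11_inv L M \<alpha> Q (par d) $ i $ j) / d ^ 4"
    using I_ev E_ev s_ev eventually_gt_at_top[of 0]
  proof eventually_elim
    case (elim d)
    have "matrix_inv (T11 L M \<alpha> Q (par d)) = T11_inv L M \<alpha> Q (par d)"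
      using elim L Z by (intro matrix_inv_eqI T11_inverse) auto
    moreover have "CRB_known_contour L M (E d) N0 \<alpha> Q (par d) = inverse (2 * E d / N0) *\<^sub>R matrix_inv (?I d)"
      unfolding CRB_known_contour_def EFIM11_par using elim N0 by (intro matrix_inv_scaleR) auto
    moreover have "inverse (2 * E d / N0) / d ^ 4 = N0 / (2 * G * N * ?s d)"
      using elim by (simp add: E_eq field_simps)
    ultimately show ?case
      by (simp add: right_diff_distrib diff_divide_distrib flip: times_divide_eq_left)
  qed
  ultimately have "((\<lambda>d. (CRB_known_contour L M (E d) N0 \<alpha> Q (par d) $ i $ j
          - inverse (2 * (E d / N0)) * T11_inv L M \<alpha> Q (par d) $ i $ j) / d ^ 4) \<longlongrightarrow> 0) at_top"
    using Lim_transform_eventually by fastforce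
  moreover have "\<forall>\<^sub>F d in at_top. d ^ 4 \<noteq> (0::real)"
    using eventually_gt_at_top[of 0] by eventually_elim simp
  ultimately show "(\<lambda>d. CRB_known_contour L M (E d) N0 \<alpha> Q (par d) $ i $ j
      - inverse (2 * (E d / N0)) * T11_inv L M \<alpha> Q (par d) $ i $ j) \<in> o[at_top](\<lambda>d. d ^ 4)"
    by (rule smalloI_tendsto)
qed

end

theorem proposition1:
  fixes Q N :: nat
    and a b :: "nat \<Rightarrow> real"
    and \<phi>0 \<psi> \<alpha> G N0 Brms c L M :: real
    and \<gamma> :: "real \<Rightarrow> nat \<Rightarrow> real"
    and E :: "real \<Rightarrow> real"
  assumes Q: "1 \<le> Q" and a1: "0 < a 1" and b1: "0 < b 1"
    and roughness: "0 \<le> \<alpha>"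
    and antennas: "2 \<le> N"
    and constants: "0 < G" "0 < N0" "0 < Brms" "0 < c"
    and not_endfire: "cos \<phi>0 \<noteq> 0"
    and L: "L = (4 * pi * Brms / c)\<^sup>2"
    and M: "M = pi\<^sup>2 * ((real N)\<^sup>2 - 1) / 12"
    and \<gamma>: "\<gamma> = (\<lambda>d0. param Q d0 \<phi>0 \<psi> a b)"
    and E: "E = (\<lambda>d0. received_energy G N \<alpha> Q (\<gamma> d0))"
  shows "(\<forall>\<^sub>F d0 in at_top. invertible (EFIM11 L M (E d0) N0 \<alpha> Q (\<gamma> d0)))
    \<and> (\<forall>d0>0. star_norm Q (\<gamma> d0) (w_fun \<alpha> Q (\<gamma> d0)) \<noteq> 0 \<longrightarrow>
          T11 L M \<alpha> Q (\<gamma> d0) ** T11_inv L M \<alpha> Q (\<gamma> d0) = mat 1 \<and>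
          T11_inv L M \<alpha> Q (\<gamma> d0) ** T11 L M \<alpha> Q (\<gamma> d0) = mat 1)
    \<and> (\<forall>i j. (\<lambda>d0. CRB_known_contour L M (E d0) N0 \<alpha> Q (\<gamma> d0) $ i $ j
                   - inverse (2 * (E d0 / N0)) * T11_inv L M \<alpha> Q (\<gamma> d0) $ i $ j)
              \<in> o[at_top](\<lambda>d0. d0 ^ 4))"
proof -
  interpret extended_target Q a b \<phi>0 \<psi> \<alpha>
    using Q a1 b1 roughness by unfold_locales
  have L0: "0 < L"
    using constants by (simp add: L)
  \<comment> \<open>A single antenna would give \<open>M = 0\<close>, hence \<open>Z = 0\<close> and
    a singular limit.\<close>
  have "1 < (real N)\<^sup>2"
    using antennas by (intro one_less_power) auto
  then have M0: "0 < M"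
    by (simp add: M)
  have \<gamma>_par: "\<gamma> = par"
    by (simp add: \<gamma> par_def[abs_def])
  have N: "0 < N"
    using antennas by simp
  note asymptotics = CRB_asymptotics[OF L0 M0 not_endfire constants(1,2) N]
  have "T11 L M \<alpha> Q (par d) ** T11_inv L M \<alpha> Q (par d) = mat 1 \<and>
      T11_inv L M \<alpha> Q (par d) ** T11 L M \<alpha> Q (par d) = mat 1"
    if "0 < d" "star_norm Q (par d) (w_fun \<alpha> Q (par d)) \<noteq> 0" for d
  proof -
    have "star (w_par d) (w_par d) \<noteq> 0"
      using that(2) by (simp add: star_norm_def star_prod_par[of d] star_w_fun)
    then show ?thesis
      using T11_inverse[OF that(1) L0] M0 not_endfire by simp
  qed
  then show ?thesis
    using asymptotics unfolding E \<gamma>_par by blast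
qed

end
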